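(* For every integer $n\ge0$, in $\mathbf{sSym}$, $$\tilde p_n=(-1)^nr_{(1^n,\dot0)},\qquad r_{(1^n,\dot0)}=\sum_{k=0}^n(-1)^ke_{n-k}\tilde h_k,\qquad\tilde p_n=\sum_{k=0}^n(-1)^{n-k}e_{n-k}\tilde h_k,$$ where $(1^n,\dot0)$ denotes the dotted composition $(1,\ldots,1,\dot0)$ with $n$ ones.
   Context: Let $\mathbb N=\{1,2,\ldots\}$ and $\dot{\mathbb N}_0=\{\dot0,\dot1,\dot2,\ldots\}$ (dotted copies of the nonnegative integers). A dotted composition is a finite tuple $\alpha=(\alpha_1,\ldots,\alpha_k)$ with entries in $\mathbb N\cup\dot{\mathbb N}_0$. For entries not both dotted put $m\oplus n=m+n$ and $m\oplus\dot n=\dot m\oplus n=\dot r$ with $r=m+n$. The partial order $\preceq$ on dotted compositions is the reflexive-transitive closure of the relation: $\beta$ is obtained from $\alpha$ by replacing two consecutive entries $x,y$ of $\alpha$ that are not both dotted by the single entry $x\oplus y$ (then $\alpha\preceq\beta$). $\mathbf{sNSym}$, as an algebra, is the free associative unital $\mathbb Q$-algebra on generators $H_n$ ($n\in\mathbb N$) and $H_{\dot n}=\tilde H_n$ ($n\ge0$); $H_\alpha:=H_{\alpha_1}\cdots H_{\alpha_k}$. The noncommutative Ribbon Schur functions in superspace are defined recursively by $R_\alpha=H_\alpha-\sum_{\alpha\prec\beta}R_\beta$. A superpartition is a pair $\Lambda=(\Lambda_1,\ldots,\Lambda_m;\Lambda_{m+1},\ldots,\Lambda_n)$ of integer sequences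 with $\Lambda_1>\cdots>\Lambda_m\ge0$ and $\Lambda_{m+1}\ge\cdots\ge\Lambda_n\ge1$; $\mathrm{df}(\Lambda)=m$ and $|\Lambda|=\Lambda_1+\cdots+\Lambda_n$. Let $x=(x_1,x_2,\ldots)$ be commuting variables and $\theta=(\theta_1,\theta_2,\ldots)$ anticommuting variables ($\theta_i\theta_j=-\theta_j\theta_i$, $\theta_i^2=0$), the $\theta$'s commuting with the $x$'s. $\mathbf{sSym}$ is the $\mathbb Q$-algebra of bounded-degree formal power series in $x,\theta$ invariant under all simultaneous permutations of the $x_i$ and $\theta_i$. The monomial function $m_\Lambda$ is the sum of all distinct terms $\theta_{i_1}\cdots\theta_{i_m}x_{i_1}^{\Lambda_1}\cdots x_{i_n}^{\Lambda_n}$ with $i_1,\ldots,i_n$ pairwise distinct. Put $h_r=\sum_{|\Lambda|=r,\,\mathrm{df}(\Lambda)=0}m_\Lambda$ and $e_r=m_{(\emptyset;1^r)}$ for $r\ge1$, $e_0=1$; and for $k\ge0$, $\tilde h_k=\sum_{|\Lambda|=k,\,\mathrm{df}(\Lambda)=1}(\Lambda_1+1)m_\Lambda$ and $\tilde p_k=\sum_i\theta_ix_i^k$. $\pi:\mathbf{sNSym}\to\mathbf{sSym}$ is the algebra morphism with $\pi(H_n)=h_n$ and $\pi(\tilde H_n)=\tilde h_n$; $r_\alpha:=\pi(R_\alpha)$. *)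

theory Defs
  imports Complex_Main "HOL-Library.Poly_Mapping"
begin

section \<open>Formal power series in commuting and anticommuting variables\<close>

text \<open>
  The variables are indexed by \<open>0, 1, 2, \<dots>\<close> instead of \<open>1, 2, 3, \<dots>\<close>.
  The pair \<open>({s\<^sub>1 < \<dots> < s\<^sub>k}, a)\<close> stands for the monomial
  \<open>\<theta>\<^bsub>s\<^sub>1\<^esub> \<cdots> \<theta>\<^bsub>s\<^sub>k\<^esub> \<Prod>\<^sub>i x\<^sub>i\<^bsup>a(i)\<^esup>\<close> with the \<open>\<theta>\<close>'s in increasing order.
  Only finite index sets give monomials; coefficients at infinite sets are fixed to be 0.
\<close>

type_synonym smon = "nat set \<times> (nat \<Rightarrow>\<^sub>0 nat)"

typedef sps = "{f :: smon \<Rightarrow> rat. \<forall>M. infinite (fst M) \<longrightarrow> f M = 0}"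
  morphisms coeff Abs_sps
  by (rule exI[of _ "\<lambda>_. 0"]) simp

setup_lifting type_definition_sps

lemma coeff_infinite [simp]: "infinite (fst M) \<Longrightarrow> coeff f M = 0"
  using coeff[of f] by blast

lemma sps_eqI: "(\<And>M. finite (fst M) \<Longrightarrow> coeff f M = coeff g M) \<Longrightarrow> f = g"
  by (metis coeff_infinite coeff_inject ext)

text \<open>
  For disjoint \<open>S\<close> and \<open>T\<close>, the product of the increasing \<open>\<theta>\<close>-monomials of \<open>S\<close> and \<open>T\<close> is
  \<open>ksgn S T\<close> times that of \<open>S \<union> T\<close>; for non-disjoint ones it vanishes.
\<close>

definition ksgn :: "nat set \<Rightarrow> nat set \<Rightarrow> rat" where
  "ksgn S T = (- 1) ^ card {(s, t). s \<in> S \<and> t \<in> T \<and> t < s}"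

text \<open>
  The ways to split the variables of a monomial between two factors (the pairs with disjoint
  \<open>\<theta>\<close>-parts are the only ones with a nonzero product).
\<close>

definition decs :: "smon \<Rightarrow> (smon \<times> smon) set" where
  "decs M = {(P, Q). fst P \<union> fst Q = fst M \<and> fst P \<inter> fst Q = {} \<and> snd P + snd Q = snd M}"

lemma times_aux:
  assumes f: "\<And>M. infinite (fst M) \<Longrightarrow> f M = 0" and g: "\<And>M. infinite (fst M) \<Longrightarrow> g M = (0 :: rat)"
    and M: "infinite (fst M)"
  shows "(\<Sum>(P, Q)\<in>decs M. ksgn (fst P) (fst Q) * f P * g Q) = 0"
proof -
  have "f P = 0 \<or> g Q = 0" if "(P, Q) \<in> decs M" for P Q
  proof -
    have "infinite (fst P) \<or> infinite (fst Q)"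
      using that M by (metis (mono_tags, lifting) decs_def case_prodD finite_UnI mem_Collect_eq)
    with f g show ?thesis by blast
  qed
  then show ?thesis
    by (intro sum.neutral) fastforce
qed

instantiation sps :: "{zero, one, plus, minus, uminus, times}"
begin

lift_definition zero_sps :: sps is "\<lambda>_. 0" by simp
lift_definition one_sps :: sps is "\<lambda>M. if M = ({}, 0) then 1 else 0" by auto
lift_definition plus_sps :: "sps \<Rightarrow> sps \<Rightarrow> sps" is "\<lambda>f g M. f M + g M" by simp
lift_definition minus_sps :: "sps \<Rightarrow> sps \<Rightarrow> sps" is "\<lambda>f g M. f M - g M" by simp
lift_definition uminus_sps :: "sps \<Rightarrow> sps" is "\<lambda>f M. - f M" by simp
lift_definition times_sps :: "sps \<Rightarrow> sps \<Rightarrow> sps" is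
  "\<lambda>f g M. \<Sum>(P, Q)\<in>decs M. ksgn (fst P) (fst Q) * f P * g Q"
  by (rule times_aux)

instance ..

end

lift_definition qscale :: "rat \<Rightarrow> sps \<Rightarrow> sps" is "\<lambda>c f M. c * f M" by simp

lift_definition theta :: "nat \<Rightarrow> sps" is "\<lambda>i M. if M = ({i}, 0) then 1 else 0" by auto

lift_definition xvar :: "nat \<Rightarrow> sps" is
  "\<lambda>i M. if M = ({}, Poly_Mapping.single i 1) then 1 else 0" by auto

lemmas coeff_simps = zero_sps.rep_eq one_sps.rep_eq plus_sps.rep_eq minus_sps.rep_eq
  uminus_sps.rep_eq qscale.rep_eq

lemma finite_add_decomps: "finite {(a, b). a + b = (c :: nat \<Rightarrow>\<^sub>0 nat)}"
proof -
  let ?A = "{a :: nat \<Rightarrow>\<^sub>0 nat. \<forall>i. Poly_Mapping.lookup a i \<le> Poly_Mapping.lookup c i}"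
  let ?F = "{f :: nat \<Rightarrow> nat. \<forall>i. (i \<in> Poly_Mapping.keys c \<longrightarrow> f i \<in> {..Max (Poly_Mapping.lookup c ` Poly_Mapping.keys c)}) \<and> (i \<notin> Poly_Mapping.keys c \<longrightarrow> f i = 0)}"
  have "Poly_Mapping.lookup ` ?A \<subseteq> ?F"
  proof safe
    fix a i assume a: "\<forall>i. Poly_Mapping.lookup a i \<le> Poly_Mapping.lookup c i"
    { assume "i \<in> Poly_Mapping.keys c"
      then have "Poly_Mapping.lookup c i \<le> Max (Poly_Mapping.lookup c ` Poly_Mapping.keys c)" by (intro Max_ge) auto
      with a show "Poly_Mapping.lookup a i \<le> Max (Poly_Mapping.lookup c ` Poly_Mapping.keys c)" by (meson le_trans) }
    { assume "i \<notin> Poly_Mapping.keys c"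
      then show "Poly_Mapping.lookup a i = 0" using a by (metis in_keys_iff le_zero_eq) }
  qed
  moreover have "finite ?F" by (rule finite_set_of_finite_funs) auto
  ultimately have "finite (Poly_Mapping.lookup ` ?A)" by (rule finite_subset)
  then have A: "finite ?A"
    by (rule finite_imageD) (rule inj_onI, simp add: lookup_inject)
  have "{(a, b). a + b = c} \<subseteq> ?A \<times> ?A" by (auto simp: lookup_add)
  then show ?thesis by (rule finite_subset) (intro finite_cartesian_product A)
qed

lemma finite_decs [simp]: "finite (fst M) \<Longrightarrow> finite (decs M)"
proof -
  assume fin: "finite (fst M)"
  let ?f = "\<lambda>((S, T), (a, b)). ((S, a), (T, b))"
  have sub: "decs M \<subseteq> ?f ` ((Pow (fst M) \<times> Pow (fst M)) \<times> {(a, b). a + b = snd M})"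
  proof
    fix z assume z: "z \<in> decs M"
    obtain S a T b where "z = ((S, a), (T, b))" by (metis surj_pair)
    with z show "z \<in> ?f ` ((Pow (fst M) \<times> Pow (fst M)) \<times> {(a, b). a + b = snd M})"
      by (intro image_eqI[of _ _ "((S, T), (a, b))"]) (auto simp: decs_def)
  qed
  show ?thesis
    by (rule finite_subset[OF sub]) (intro finite_imageI finite_cartesian_product finite_add_decomps; simp add: fin)
qed

lemma finite_inv_pairs: "finite S \<Longrightarrow> finite T \<Longrightarrow> finite {(s, t). s \<in> S \<and> t \<in> T \<and> R s t}"
  by (rule finite_subset[of _ "S \<times> T"]) auto

lemma ksgn_Un_left:
  assumes "finite S" "finite T" "finite U" "S \<inter> T = {}"
  shows "ksgn (S \<union> T) U = ksgn S U * ksgn T U"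
proof -
  have "{(s, t). s \<in> S \<union> T \<and> t \<in> U \<and> t < s} =
      {(s, t). s \<in> S \<and> t \<in> U \<and> t < s} \<union> {(s, t). s \<in> T \<and> t \<in> U \<and> t < s}" by auto
  moreover have "card \<dots> = card {(s, t). s \<in> S \<and> t \<in> U \<and> t < s}
      + card {(s, t). s \<in> T \<and> t \<in> U \<and> t < s}"
    by (rule card_Un_disjoint) (use assms in \<open>auto intro: finite_inv_pairs\<close>)
  ultimately show ?thesis by (simp add: ksgn_def power_add)
qed

lemma ksgn_Un_right:
  assumes "finite S" "finite T" "finite U" "T \<inter> U = {}"
  shows "ksgn S (T \<union> U) = ksgn S T * ksgn S U"
proof -
  have "{(s, t). s \<in> S \<and> t \<in> T \<union> U \<and> t < s} =
      {(s, t). s \<in> S \<and> t \<in> T \<and> t < s} \<union> {(s, t). s \<in> S \<and> t \<in> U \<and> t < s}" by auto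
  moreover have "card \<dots> = card {(s, t). s \<in> S \<and> t \<in> T \<and> t < s}
      + card {(s, t). s \<in> S \<and> t \<in> U \<and> t < s}"
    by (rule card_Un_disjoint) (use assms in \<open>auto intro: finite_inv_pairs\<close>)
  ultimately show ?thesis by (simp add: ksgn_def power_add)
qed

lemma ksgn_empty [simp]: "ksgn {} T = 1" "ksgn S {} = 1"
  by (simp_all add: ksgn_def)

lemma coeff_times:
  "coeff (f * g) M = (\<Sum>(P, Q)\<in>decs M. ksgn (fst P) (fst Q) * coeff f P * coeff g Q)"
  by (simp add: times_sps.rep_eq)

lemma decs_finite:
  "(P, Q) \<in> decs M \<Longrightarrow> finite (fst M) \<Longrightarrow> finite (fst P) \<and> finite (fst Q)"
  by (auto simp: decs_def) (metis finite_Un)+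

lemma coeff_times':
  "coeff (f * g) M = (\<Sum>z\<in>decs M. ksgn (fst (fst z)) (fst (snd z)) * coeff f (fst z) * coeff g (snd z))"
  by (simp add: coeff_times case_prod_unfold)

lemma decsD:
  assumes "z \<in> decs M"
  shows "fst (fst z) \<union> fst (snd z) = fst M" "fst (fst z) \<inter> fst (snd z) = {}"
    "snd (fst z) + snd (snd z) = snd M"
    "finite (fst M) \<Longrightarrow> finite (fst (fst z))" "finite (fst M) \<Longrightarrow> finite (fst (snd z))"
  using assms decs_finite[of "fst z" "snd z" M] by (auto simp: decs_def)

lemma decsI:
  assumes "fst (fst z) \<union> fst (snd z) = fst M" "fst (fst z) \<inter> fst (snd z) = {}"
    "snd (fst z) + snd (snd z) = snd M"
  shows "z \<in> decs M"
  using assms by (cases z) (simp add: decs_def)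

lemma sps_mult_assoc: "(f * g) * h = f * (g * (h :: sps))"
proof (rule sps_eqI)
  fix M :: smon assume M: "finite (fst M)"
  let ?t = "\<lambda>P Q R. ksgn (fst P) (fst Q) * ksgn (fst P) (fst R) * ksgn (fst Q) (fst R)
     * coeff f P * coeff g Q * coeff h R"
  let ?L = "SIGMA z:decs M. decs (fst z)" and ?R = "SIGMA z:decs M. decs (snd z)"
  have "coeff ((f * g) * h) M
     = (\<Sum>z\<in>decs M. \<Sum>y\<in>decs (fst z). ?t (fst y) (snd y) (snd z))"
    unfolding coeff_times'[of "f * g"]
  proof (rule sum.cong[OF refl])
    fix z assume z: "z \<in> decs M"
    note zD = decsD(4,5)[OF z M]
    show "ksgn (fst (fst z)) (fst (snd z)) * coeff (f * g) (fst z) * coeff h (snd z)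
      = (\<Sum>y\<in>decs (fst z). ?t (fst y) (snd y) (snd z))"
      unfolding coeff_times' sum_distrib_left sum_distrib_right
    proof (rule sum.cong[OF refl])
      fix y assume y: "y \<in> decs (fst z)"
      have "ksgn (fst (fst z)) (fst (snd z))
          = ksgn (fst (fst y)) (fst (snd z)) * ksgn (fst (snd y)) (fst (snd z))"
        unfolding decsD(1)[OF y, symmetric]
        by (rule ksgn_Un_left) (use decsD[OF y] zD in auto)
      then show "ksgn (fst (fst z)) (fst (snd z))
          * (ksgn (fst (fst y)) (fst (snd y)) * coeff f (fst y) * coeff g (snd y)) * coeff h (snd z)
        = ?t (fst y) (snd y) (snd z)" by simp
    qed
  qed
  also have "\<dots> = (\<Sum>(z, y)\<in>?L. ?t (fst y) (snd y) (snd z))"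
    by (rule sum.Sigma) (use M decsD in auto)
  also have "\<dots> = (\<Sum>(z, y)\<in>?R. ?t (fst z) (fst y) (snd y))"
  proof (rule sum.reindex_bij_witness
      [where j = "\<lambda>w. ((fst (snd w), (fst (snd (snd w)) \<union> fst (snd (fst w)), snd (snd (snd w)) + snd (snd (fst w)))),
                        (snd (snd w), snd (fst w)))"
         and i = "\<lambda>w. (((fst (fst (fst w)) \<union> fst (fst (snd w)), snd (fst (fst w)) + snd (fst (snd w))), snd (snd w)),
                        (fst (fst w), fst (snd w)))"])
    fix w assume "w \<in> ?L"
    then have a: "fst w \<in> decs M" "snd w \<in> decs (fst (fst w))" by auto
    note d = decsD(1-3)[OF a(1)] decsD(1-3)[OF a(2)]
    let ?j = "((fst (snd w), (fst (snd (snd w)) \<union> fst (snd (fst w)), snd (snd (snd w)) + snd (snd (fst w)))),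
                        (snd (snd w), snd (fst w)))"
    show "(((fst (fst (fst ?j)) \<union> fst (fst (snd ?j)), snd (fst (fst ?j)) + snd (fst (snd ?j))), snd (snd ?j)),
                        (fst (fst ?j), fst (snd ?j))) = w"
      using d by (simp add: prod_eq_iff)
    have "fst ?j \<in> decs M"
      by (rule decsI) (use d in \<open>auto simp: add.assoc[symmetric]\<close>)
    moreover have "snd ?j \<in> decs (snd (fst ?j))"
      by (rule decsI) (use d in auto)
    ultimately show "?j \<in> ?R" by simp
    show "(case ?j of (z, y) \<Rightarrow> ?t (fst z) (fst y) (snd y)) = (case w of (z, y) \<Rightarrow> ?t (fst y) (snd y) (snd z))"
      by (simp add: case_prod_unfold)
  next
    fix w assume "w \<in> ?R"
    then have a: "fst w \<in> decs M" "snd w \<in> decs (snd (fst w))" by auto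
    note d = decsD(1-3)[OF a(1)] decsD(1-3)[OF a(2)]
    let ?i = "(((fst (fst (fst w)) \<union> fst (fst (snd w)), snd (fst (fst w)) + snd (fst (snd w))), snd (snd w)),
                        (fst (fst w), fst (snd w)))"
    show "((fst (snd ?i), (fst (snd (snd ?i)) \<union> fst (snd (fst ?i)), snd (snd (snd ?i)) + snd (snd (fst ?i)))),
                        (snd (snd ?i), snd (fst ?i))) = w"
      using d by (simp add: prod_eq_iff)
    have "fst ?i \<in> decs M"
      by (rule decsI) (use d in \<open>auto simp: add.assoc\<close>)
    moreover have "snd ?i \<in> decs (fst (fst ?i))"
      by (rule decsI) (use d in auto)
    ultimately show "?i \<in> ?L" by simp
  qed
  also have "\<dots> = (\<Sum>z\<in>decs M. \<Sum>y\<in>decs (snd z). ?t (fst z) (fst y) (snd y))"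
    by (rule sum.Sigma[symmetric]) (use M decsD in auto)
  also have "\<dots> = coeff (f * (g * h)) M"
    unfolding coeff_times'[of f "g * h"]
  proof (rule sum.cong[OF refl])
    fix z assume z: "z \<in> decs M"
    note zD = decsD(4,5)[OF z M]
    show "(\<Sum>y\<in>decs (snd z). ?t (fst z) (fst y) (snd y))
      = ksgn (fst (fst z)) (fst (snd z)) * coeff f (fst z) * coeff (g * h) (snd z)"
      unfolding coeff_times' sum_distrib_left sum_distrib_right
    proof (rule sum.cong[OF refl])
      fix y assume y: "y \<in> decs (snd z)"
      have "ksgn (fst (fst z)) (fst (snd z))
          = ksgn (fst (fst z)) (fst (fst y)) * ksgn (fst (fst z)) (fst (snd y))"
        unfolding decsD(1)[OF y, symmetric]
        by (rule ksgn_Un_right) (use decsD[OF y] zD in auto)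
      then show "?t (fst z) (fst y) (snd y)
        = ksgn (fst (fst z)) (fst (snd z)) * coeff f (fst z)
          * (ksgn (fst (fst y)) (fst (snd y)) * coeff g (fst y) * coeff h (snd y))" by simp
    qed
  qed
  finally show "coeff ((f * g) * h) M = coeff (f * (g * h)) M" .
qed

lemma sps_one_left: "1 * f = (f :: sps)"
proof (rule sps_eqI)
  fix M :: smon assume M: "finite (fst M)"
  have mem: "(({}, 0), M) \<in> decs M" by (rule decsI) auto
  have "z = (({}, 0), M)" if "z \<in> decs M" "fst z = ({}, 0)" for z
    using decsD(1,3)[OF that(1)] that(2) by (cases z) (simp add: prod_eq_iff)
  then have *: "(fst z = ({}, 0) \<longrightarrow> z = (({}, 0), M))" if "z \<in> decs M" for z
    using that by blast
  have "coeff (1 * f) M = (\<Sum>z\<in>decs M. if z = (({}, 0), M) then coeff f M else 0)"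
    unfolding coeff_times' one_sps.rep_eq
  proof (rule sum.cong[OF refl])
    fix z assume z: "z \<in> decs M"
    show "ksgn (fst (fst z)) (fst (snd z)) * (if fst z = ({}, 0) then 1 else 0) * coeff f (snd z)
        = (if z = (({}, 0), M) then coeff f M else 0)"
    proof (cases "fst z = ({}, 0)")
      case True
      then have "z = (({}, 0), M)" using *[OF z] by blast
      then show ?thesis by simp
    next
      case False
      then have "z \<noteq> (({}, 0), M)" by auto
      with False show ?thesis by simp
    qed
  qed
  also have "\<dots> = coeff f M" using M mem by simp
  finally show "coeff (1 * f) M = coeff f M" .
qed

lemma sps_one_right: "f * 1 = (f :: sps)"
proof (rule sps_eqI)
  fix M :: smon assume M: "finite (fst M)"
  have mem: "(M, ({}, 0)) \<in> decs M" by (rule decsI) auto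
  have "z = (M, ({}, 0))" if "z \<in> decs M" "snd z = ({}, 0)" for z
    using decsD(1,3)[OF that(1)] that(2) by (cases z) (simp add: prod_eq_iff)
  then have *: "(snd z = ({}, 0) \<longrightarrow> z = (M, ({}, 0)))" if "z \<in> decs M" for z
    using that by blast
  have "coeff (f * 1) M = (\<Sum>z\<in>decs M. if z = (M, ({}, 0)) then coeff f M else 0)"
    unfolding coeff_times' one_sps.rep_eq
  proof (rule sum.cong[OF refl])
    fix z assume z: "z \<in> decs M"
    show "ksgn (fst (fst z)) (fst (snd z)) * coeff f (fst z) * (if snd z = ({}, 0) then 1 else 0)
        = (if z = (M, ({}, 0)) then coeff f M else 0)"
    proof (cases "snd z = ({}, 0)")
      case True
      then have "z = (M, ({}, 0))" using *[OF z] by blast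
      then show ?thesis by simp
    next
      case False
      then have "z \<noteq> (M, ({}, 0))" by auto
      with False show ?thesis by simp
    qed
  qed
  also have "\<dots> = coeff f M" using M mem by simp
  finally show "coeff (f * 1) M = coeff f M" .
qed

instance sps :: ring_1
proof
  fix f g h :: sps
  show "f * g * h = f * (g * h)" by (rule sps_mult_assoc)
  show "f + g + h = f + (g + h)" by transfer (simp add: add.assoc)
  show "f + g = g + f" by transfer (simp add: add.commute)
  show "0 + f = f" by transfer simp
  show "- f + f = 0" by transfer simp
  show "f - g = f + - g" by transfer simp
  show "1 * f = f" by (rule sps_one_left)
  show "f * 1 = f" by (rule sps_one_right)
  show "(f + g) * h = f * h + g * h"
    by (rule sps_eqI)
       (simp add: coeff_times coeff_simps algebra_simps case_prod_unfold sum.distrib)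
  show "f * (g + h) = f * g + f * h"
    by (rule sps_eqI)
       (simp add: coeff_times coeff_simps algebra_simps case_prod_unfold sum.distrib)
  show "(0::sps) \<noteq> 1"
  proof
    assume "(0::sps) = 1"
    then have "coeff 0 ({}, 0) = coeff 1 ({}, 0)" by simp
    then show False by (simp add: coeff_simps)
  qed
qed


section \<open>Symmetric functions in superspace\<close>

definition mdeg :: "smon \<Rightarrow> nat" where
  "mdeg M = card (fst M) + (\<Sum>i\<in>Poly_Mapping.keys (snd M). Poly_Mapping.lookup (snd M) i)"

definition deg_le :: "nat \<Rightarrow> sps \<Rightarrow> bool" where
  "deg_le d f \<longleftrightarrow> (\<forall>M. coeff f M \<noteq> 0 \<longrightarrow> mdeg M \<le> d)"

text \<open>
  Substituting \<open>x\<^sub>i \<mapsto> x\<^bsub>\<sigma>(i)\<^esub>\<close> and \<open>\<theta>\<^sub>i \<mapsto> \<theta>\<^bsub>\<sigma>(i)\<^esub>\<close> sends the monomial \<open>(T, b)\<close> to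
  \<open>psgn \<sigma> T\<close> times \<open>(\<sigma>(T), b \<circ> \<sigma>\<^sup>-\<^sup>1)\<close>, the sign coming from putting the \<open>\<theta>\<close>'s back in
  increasing order. So the coefficient at \<open>(S, a)\<close> of the result is \<open>psgn \<sigma> T\<close> times the old one
  at \<open>(T, a \<circ> \<sigma>)\<close>, \<open>T = \<sigma>\<^sup>-\<^sup>1(S)\<close>.
\<close>

definition psgn :: "(nat \<Rightarrow> nat) \<Rightarrow> nat set \<Rightarrow> rat" where
  "psgn \<sigma> S = (- 1) ^ card {(i, j). i \<in> S \<and> j \<in> S \<and> i < j \<and> \<sigma> j < \<sigma> i}"

lemma finite_vimage_bij: "bij \<sigma> \<Longrightarrow> finite (\<sigma> -` S) \<longleftrightarrow> finite S"
  by (metis bij_is_inj bij_is_surj finite_imageI finite_vimageI surj_image_vimage_eq)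

lift_definition act :: "(nat \<Rightarrow> nat) \<Rightarrow> sps \<Rightarrow> sps" is
  "\<lambda>\<sigma> f M. if bij \<sigma>
     then psgn \<sigma> (\<sigma> -` fst M) * f (\<sigma> -` fst M, Poly_Mapping.map_key \<sigma> (snd M)) else 0"
  by (auto simp: finite_vimage_bij)

lemma coeff_act:
  "bij \<sigma> \<Longrightarrow> coeff (act \<sigma> f) M =
     psgn \<sigma> (\<sigma> -` fst M) * coeff f (\<sigma> -` fst M, Poly_Mapping.map_key \<sigma> (snd M))"
  by (simp add: act.rep_eq)

lemma lookup_map_key: "inj \<sigma> \<Longrightarrow> Poly_Mapping.lookup (Poly_Mapping.map_key \<sigma> a) i = Poly_Mapping.lookup a (\<sigma> i)"
  by (simp add: Poly_Mapping.map_key.rep_eq)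

lemma map_key_eq_single:
  "bij \<sigma> \<Longrightarrow> Poly_Mapping.map_key \<sigma> a = Poly_Mapping.single i v \<longleftrightarrow> a = Poly_Mapping.single (\<sigma> i) v"
proof
  assume b: "bij \<sigma>" and e: "Poly_Mapping.map_key \<sigma> a = Poly_Mapping.single i v"
  show "a = Poly_Mapping.single (\<sigma> i) v"
  proof (rule poly_mapping_eqI)
    fix k obtain l where k: "k = \<sigma> l" using b by (metis bij_pointE)
    have "Poly_Mapping.lookup a k = Poly_Mapping.lookup (Poly_Mapping.single i v) l"
      using b by (simp add: k e[symmetric] lookup_map_key bij_is_inj)
    then show "Poly_Mapping.lookup a k = Poly_Mapping.lookup (Poly_Mapping.single (\<sigma> i) v) k"
      using b by (auto simp: k lookup_single when_def bij_is_inj inj_eq)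
  qed
next
  assume "bij \<sigma>" "a = Poly_Mapping.single (\<sigma> i) v"
  then show "Poly_Mapping.map_key \<sigma> a = Poly_Mapping.single i v" by (simp add: bij_is_inj)
qed

lemma map_key_eq_0: "bij \<sigma> \<Longrightarrow> Poly_Mapping.map_key \<sigma> a = 0 \<longleftrightarrow> a = 0"
  using map_key_eq_single[of \<sigma> a undefined 0] by simp

lemma vimage_eq_iff:
  assumes "bij \<sigma>" shows "\<sigma> -` S = T \<longleftrightarrow> S = \<sigma> ` T"
proof
  assume "\<sigma> -` S = T"
  then show "S = \<sigma> ` T" using surj_image_vimage_eq[OF bij_is_surj[OF assms], of S] by simp
next
  assume "S = \<sigma> ` T"
  then show "\<sigma> -` S = T" using inj_vimage_image_eq[OF bij_is_inj[OF assms], of T] by simp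
qed

lemma vimage_eq_singleton: "bij \<sigma> \<Longrightarrow> \<sigma> -` S = {i} \<longleftrightarrow> S = {\<sigma> i}"
  by (simp add: vimage_eq_iff)

lemma vimage_eq_empty: "bij \<sigma> \<Longrightarrow> \<sigma> -` S = {} \<longleftrightarrow> S = {}"
  by (simp add: vimage_eq_iff)

lemma psgn_empty [simp]: "psgn \<sigma> {} = 1" and psgn_singleton [simp]: "psgn \<sigma> {i} = 1"
proof -
  have "{(k, j). k \<in> {i} \<and> j \<in> {i} \<and> k < j \<and> \<sigma> j < \<sigma> k} = {}" by auto
  then show "psgn \<sigma> {i} = 1" unfolding psgn_def by (metis card.empty power_0)
qed (simp add: psgn_def)

lemma psgn_nz: "psgn \<sigma> S \<noteq> 0" by (simp add: psgn_def)

lemma act_theta: "bij \<sigma> \<Longrightarrow> act \<sigma> (theta i) = theta (\<sigma> i)"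
proof (rule sps_eqI)
  fix M assume \<sigma>: "bij \<sigma>"
  have "psgn \<sigma> (\<sigma> -` {\<sigma> i}) = 1"
    using vimage_eq_singleton[OF \<sigma>, of "{\<sigma> i}" i] by simp
  with \<sigma> show "coeff (act \<sigma> (theta i)) M = coeff (theta (\<sigma> i)) M"
    by (simp add: coeff_act theta.rep_eq prod_eq_iff vimage_eq_singleton map_key_eq_0)
qed

lemma act_xvar: "bij \<sigma> \<Longrightarrow> act \<sigma> (xvar i) = xvar (\<sigma> i)"
  by (rule sps_eqI)
     (simp add: coeff_act xvar.rep_eq prod_eq_iff vimage_eq_empty map_key_eq_single)

lemma act_one: "bij \<sigma> \<Longrightarrow> act \<sigma> 1 = 1"
  by (rule sps_eqI)
     (simp add: coeff_act one_sps.rep_eq prod_eq_iff vimage_eq_empty map_key_eq_0)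

lemma act_zero: "act \<sigma> 0 = 0"
  by (rule sps_eqI) (auto simp: act.rep_eq zero_sps.rep_eq)

lemma act_add: "act \<sigma> (f + g) = act \<sigma> f + act \<sigma> g"
  by (rule sps_eqI) (auto simp: act.rep_eq coeff_simps algebra_simps)

lemma act_minus: "act \<sigma> (f - g) = act \<sigma> f - act \<sigma> g"
  by (rule sps_eqI) (auto simp: act.rep_eq coeff_simps algebra_simps)

lemma act_uminus: "act \<sigma> (- f) = - act \<sigma> f"
  by (rule sps_eqI) (auto simp: act.rep_eq coeff_simps algebra_simps)

lemma act_scale: "act \<sigma> (qscale c f) = qscale c (act \<sigma> f)"
  by (rule sps_eqI) (auto simp: act.rep_eq coeff_simps algebra_simps)

lemma psgn_Un:
  assumes \<sigma>: "bij \<sigma>" and fin: "finite S" "finite T" and disj: "S \<inter> T = {}"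
  shows "psgn \<sigma> (S \<union> T) * ksgn S T = psgn \<sigma> S * psgn \<sigma> T * ksgn (\<sigma> ` S) (\<sigma> ` T)"
proof -
  let ?I = "\<lambda>A B. {(i, j). i \<in> A \<and> j \<in> B \<and> i < j \<and> \<sigma> j < \<sigma> i}"
  let ?K = "{(s, t). s \<in> S \<and> t \<in> T \<and> t < s}"
  let ?L = "{(s, t). s \<in> S \<and> t \<in> T \<and> \<sigma> t < \<sigma> s}"
  note fi = finite_inv_pairs
  have inj: "inj \<sigma>" using \<sigma> by (rule bij_is_inj)
  have U: "?I (S \<union> T) (S \<union> T) = (?I S S \<union> ?I T T) \<union> (?I S T \<union> ?I T S)" by auto
  have c1: "card (?I (S \<union> T) (S \<union> T)) = card (?I S S \<union> ?I T T) + card (?I S T \<union> ?I T S)"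
    unfolding U by (rule card_Un_disjoint) (use fin disj in \<open>auto intro: fi\<close>)
  have c2: "card (?I S S \<union> ?I T T) = card (?I S S) + card (?I T T)"
    by (rule card_Un_disjoint) (use fin disj in \<open>auto intro: fi\<close>)
  have c3: "card (?I S T \<union> ?I T S) = card (?I S T) + card (?I T S)"
    by (rule card_Un_disjoint) (use fin disj in \<open>auto intro: fi\<close>)
  have ne: "i \<noteq> j \<and> \<sigma> i \<noteq> \<sigma> j" if "i \<in> S" "j \<in> T" for i j
    using that disj inj by (metis disjoint_iff inj_eq)
  have st: "?I S T = ?L - ?K"
    using ne by (force simp: not_less)
  have "?I T S = prod.swap ` {(s, t). s \<in> S \<and> t \<in> T \<and> t < s \<and> \<sigma> s < \<sigma> t}"
    by force
  moreover have "{(s, t). s \<in> S \<and> t \<in> T \<and> t < s \<and> \<sigma> s < \<sigma> t} = ?K - ?L"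
    using ne by (force simp: not_less)
  ultimately have ts: "card (?I T S) = card (?K - ?L)"
    by (simp add: card_image)
  have finK: "finite ?K" "finite ?L" using fin by (auto intro: fi)
  have k1: "card ?K = card (?K - ?L) + card (?K \<inter> ?L)"
    using card_Int_Diff[OF finK(1), of ?L] by simp
  have k2: "card ?L = card (?L - ?K) + card (?K \<inter> ?L)"
    using card_Int_Diff[OF finK(2), of ?K] by (simp add: Int_commute)
  have L: "card {(s, t). s \<in> \<sigma> ` S \<and> t \<in> \<sigma> ` T \<and> t < s} = card ?L"
  proof -
    have "{(s, t). s \<in> \<sigma> ` S \<and> t \<in> \<sigma> ` T \<and> t < s} = map_prod \<sigma> \<sigma> ` ?L" by auto
    moreover have "inj_on (map_prod \<sigma> \<sigma>) ?L"
      using inj by (auto simp: inj_on_def)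
    ultimately show ?thesis by (simp add: card_image)
  qed
  have P: "card (?I (S \<union> T) (S \<union> T)) = card (?I S S) + card (?I T T) + card (?L - ?K) + card (?K - ?L)"
    using c1 c2 c3 ts arg_cong[OF st, of card] by linarith
  have "card (?I (S \<union> T) (S \<union> T)) + card ?K
      = card (?I S S) + card (?I T T) + card ?L + 2 * card (?K - ?L)"
    using P k1 k2 by linarith
  then have "(- 1 :: rat) ^ (card (?I (S \<union> T) (S \<union> T)) + card ?K)
      = (- 1) ^ (card (?I S S) + card (?I T T) + card ?L)"
    by (simp add: power_add power_mult)
  then show ?thesis
    unfolding psgn_def ksgn_def L power_add .
qed

lemma act_mult:
  assumes \<sigma>: "bij \<sigma>" shows "act \<sigma> (f * g) = act \<sigma> f * act \<sigma> g"
proof (rule sps_eqI)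
  fix M :: smon assume M: "finite (fst M)"
  let ?pull = "\<lambda>P::smon. (\<sigma> -` fst P, Poly_Mapping.map_key \<sigma> (snd P))"
  let ?push = "\<lambda>P::smon. (\<sigma> ` fst P, Poly_Mapping.map_key (inv \<sigma>) (snd P))"
  have inj: "inj \<sigma>" and surj: "surj \<sigma>" using \<sigma> by (auto simp: bij_def)
  have injv: "inj (inv \<sigma>)" using surj by (rule surj_imp_inj_inv)
  have pp: "?push (?pull P) = P" "?pull (?push P) = P" for P
    using inj surj injv
    by (auto simp: prod_eq_iff surj_image_vimage_eq inj_vimage_image_eq lookup_map_key surj_f_inv_f
        intro!: poly_mapping_eqI)
  have sgn: "psgn \<sigma> (\<sigma> -` fst M) * ksgn (\<sigma> -` fst P) (\<sigma> -` fst Q)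
      = psgn \<sigma> (\<sigma> -` fst P) * psgn \<sigma> (\<sigma> -` fst Q) * ksgn (fst P) (fst Q)"
    if "(P, Q) \<in> decs M" for P Q
  proof -
    have "\<sigma> -` fst M = \<sigma> -` fst P \<union> \<sigma> -` fst Q" "\<sigma> -` fst P \<inter> \<sigma> -` fst Q = {}"
      using that by (auto simp: decs_def)
    moreover have "finite (\<sigma> -` fst P)" "finite (\<sigma> -` fst Q)"
      using decs_finite[OF that M] inj by (auto intro: finite_vimageI)
    ultimately show ?thesis
      using psgn_Un[OF \<sigma>, of "\<sigma> -` fst P" "\<sigma> -` fst Q"] surj by (simp add: surj_image_vimage_eq)
  qed
  have "coeff (act \<sigma> (f * g)) M = psgn \<sigma> (\<sigma> -` fst M) *
      (\<Sum>(P, Q)\<in>decs (?pull M). ksgn (fst P) (fst Q) * coeff f P * coeff g Q)"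
    by (simp add: coeff_act[OF \<sigma>] coeff_times)
  also have "(\<Sum>(P, Q)\<in>decs (?pull M). ksgn (fst P) (fst Q) * coeff f P * coeff g Q)
     = (\<Sum>(P, Q)\<in>decs M. ksgn (\<sigma> -` fst P) (\<sigma> -` fst Q) * coeff f (?pull P) * coeff g (?pull Q))"
  proof (rule sum.reindex_bij_witness
      [where j = "\<lambda>(P, Q). (?push P, ?push Q)" and i = "\<lambda>(P, Q). (?pull P, ?pull Q)"])
    fix z assume "z \<in> decs M"
    then show "(\<lambda>(P, Q). (?push P, ?push Q)) ((\<lambda>(P, Q). (?pull P, ?pull Q)) z) = z"
      using pp(1) by (auto simp: case_prod_unfold)
    show "(\<lambda>(P, Q). (?pull P, ?pull Q)) z \<in> decs (?pull M)"
      using \<open>z \<in> decs M\<close> inj by (auto simp: decs_def map_key_plus[symmetric])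
  next
    fix z assume z: "z \<in> decs (?pull M)"
    then show "(\<lambda>(P, Q). (?pull P, ?pull Q)) ((\<lambda>(P, Q). (?push P, ?push Q)) z) = z"
      using pp(2) by (auto simp: case_prod_unfold)
    obtain S a T b where zz: "z = ((S, a), (T, b))" by (metis surj_pair)
    have d: "S \<union> T = \<sigma> -` fst M" "S \<inter> T = {}" "a + b = Poly_Mapping.map_key \<sigma> (snd M)"
      using z by (auto simp: decs_def zz)
    have "\<sigma> ` S \<union> \<sigma> ` T = fst M" using d(1) surj by (metis image_Un surj_image_vimage_eq)
    moreover have "\<sigma> ` S \<inter> \<sigma> ` T = {}" using d(2) inj by (metis image_Int image_empty)
    moreover have "Poly_Mapping.map_key (inv \<sigma>) a + Poly_Mapping.map_key (inv \<sigma>) b = snd M"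
      using d(3) pp(1)[of M] by (simp add: map_key_plus[OF injv, symmetric] prod_eq_iff)
    ultimately show "(\<lambda>(P, Q). (?push P, ?push Q)) z \<in> decs M"
      by (simp add: zz decs_def)
    show "(case (\<lambda>(P, Q). (?push P, ?push Q)) z of (P, Q) \<Rightarrow>
        ksgn (\<sigma> -` fst P) (\<sigma> -` fst Q) * coeff f (?pull P) * coeff g (?pull Q))
      = (case z of (P, Q) \<Rightarrow> ksgn (fst P) (fst Q) * coeff f P * coeff g Q)"
      using pp(2)[of "(S, a)"] pp(2)[of "(T, b)"] by (simp add: zz)
  qed
  also have "psgn \<sigma> (\<sigma> -` fst M) * \<dots> = coeff (act \<sigma> f * act \<sigma> g) M"
    unfolding coeff_times sum_distrib_left
  proof (rule sum.cong[OF refl], clarify)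
    fix S a T b assume "((S, a), (T, b)) \<in> decs M"
    from sgn[OF this]
    show "psgn \<sigma> (\<sigma> -` fst M) * (ksgn (\<sigma> -` fst (S, a)) (\<sigma> -` fst (T, b))
        * coeff f (?pull (S, a)) * coeff g (?pull (T, b)))
      = ksgn (fst (S, a)) (fst (T, b)) * coeff (act \<sigma> f) (S, a) * coeff (act \<sigma> g) (T, b)"
      by (simp add: coeff_act[OF \<sigma>] mult_ac)
  qed
  finally show "coeff (act \<sigma> (f * g)) M = coeff (act \<sigma> f * act \<sigma> g) M" .
qed

lemma act_inj: assumes "bij \<sigma>" "act \<sigma> f = act \<sigma> g" shows "f = g"
proof (rule sps_eqI)
  fix M :: smon
  have s: "surj \<sigma>" "inj \<sigma>" and i: "inj (inv \<sigma>)"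
    using assms(1) by (auto simp: bij_def surj_imp_inj_inv)
  have m: "(\<sigma> -` \<sigma> ` fst M, Poly_Mapping.map_key \<sigma> (Poly_Mapping.map_key (inv \<sigma>) (snd M))) = M"
    using s i
    by (auto simp: prod_eq_iff inj_vimage_image_eq lookup_map_key intro!: poly_mapping_eqI)
  have "coeff (act \<sigma> f) (\<sigma> ` fst M, Poly_Mapping.map_key (inv \<sigma>) (snd M))
      = coeff (act \<sigma> g) (\<sigma> ` fst M, Poly_Mapping.map_key (inv \<sigma>) (snd M))"
    by (simp add: assms)
  then show "coeff f M = coeff g M"
    using m by (simp add: coeff_act[OF assms(1)] psgn_nz)
qed


lemma coeff_nz_times:
  assumes "coeff (f * g) M \<noteq> 0"
  obtains P Q where "(P, Q) \<in> decs M" "coeff f P \<noteq> 0" "coeff g Q \<noteq> 0"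
proof -
  have "\<exists>z\<in>decs M. ksgn (fst (fst z)) (fst (snd z)) * coeff f (fst z) * coeff g (snd z) \<noteq> 0"
    using assms unfolding coeff_times' by (meson sum.neutral)
  then obtain z where "z \<in> decs M" "coeff f (fst z) \<noteq> 0" "coeff g (snd z) \<noteq> 0" by auto
  then show thesis using that[of "fst z" "snd z"] by simp
qed

lemma mdeg_decs:
  assumes "(P, Q) \<in> decs M" "finite (fst M)"
  shows "mdeg M = mdeg P + mdeg Q"
proof -
  have "card (fst M) = card (fst P) + card (fst Q)"
    unfolding decsD(1)[OF assms(1), symmetric] fst_conv snd_conv
    by (rule card_Un_disjoint) (use decs_finite[OF assms] decsD(2)[OF assms(1)] in auto)
  moreover have "(\<Sum>i\<in>Poly_Mapping.keys (a + b). Poly_Mapping.lookup (a + b) i)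
     = (\<Sum>i\<in>Poly_Mapping.keys a. Poly_Mapping.lookup a i)
     + (\<Sum>i\<in>Poly_Mapping.keys b. Poly_Mapping.lookup b i)" for a b :: "nat \<Rightarrow>\<^sub>0 nat"
    by (rule setsum_keys_plus_distrib) auto
  ultimately show ?thesis using decsD(3)[OF assms(1)] by (simp add: mdeg_def flip: decsD(3)[OF assms(1)])
qed

lemma deg_leD: "deg_le d f \<Longrightarrow> coeff f M \<noteq> 0 \<Longrightarrow> mdeg M \<le> d"
  unfolding deg_le_def by blast

lemma deg_le_mono: "deg_le d f \<Longrightarrow> d \<le> e \<Longrightarrow> deg_le e f"
  by (force simp: deg_le_def)

lemma deg_le_times:
  assumes "deg_le d f" "deg_le e g" shows "deg_le (d + e) (f * g)"
  unfolding deg_le_def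
proof (intro allI impI)
  fix M assume nz: "coeff (f * g) M \<noteq> 0"
  then have fin: "finite (fst M)" using coeff_infinite by blast
  obtain P Q where PQ: "(P, Q) \<in> decs M" "coeff f P \<noteq> 0" "coeff g Q \<noteq> 0"
    using nz by (rule coeff_nz_times)
  have "mdeg P \<le> d" "mdeg Q \<le> e" using PQ(2,3) assms by (auto intro: deg_leD)
  then show "mdeg M \<le> d + e" using mdeg_decs[OF PQ(1) fin] by linarith
qed

lemma deg_le_add:
  assumes "deg_le d f" "deg_le e g" shows "deg_le (max d e) (f + g)"
  unfolding deg_le_def coeff_simps
proof (intro allI impI)
  fix M assume "coeff f M + coeff g M \<noteq> 0"
  then have "coeff f M \<noteq> 0 \<or> coeff g M \<noteq> 0" by auto
  then show "mdeg M \<le> max d e" using assms by (meson deg_leD max.coboundedI1 max.coboundedI2)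
qed

lemma deg_le_minus:
  assumes "deg_le d f" "deg_le e g" shows "deg_le (max d e) (f - g)"
  unfolding deg_le_def coeff_simps
proof (intro allI impI)
  fix M assume "coeff f M - coeff g M \<noteq> 0"
  then have "coeff f M \<noteq> 0 \<or> coeff g M \<noteq> 0" by auto
  then show "mdeg M \<le> max d e" using assms by (meson deg_leD max.coboundedI1 max.coboundedI2)
qed

lemma deg_le_uminus: "deg_le d f \<Longrightarrow> deg_le d (- f)"
  by (simp add: deg_le_def coeff_simps)

lemma deg_le_scale: "deg_le d f \<Longrightarrow> deg_le d (qscale c f)"
  by (simp add: deg_le_def coeff_simps)

lemma deg_le_0: "deg_le 0 0"
  by (simp add: deg_le_def coeff_simps)

lemma deg_le_1: "deg_le 0 1"
  by (simp add: deg_le_def coeff_simps mdeg_def)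

lemma deg_le_theta: "deg_le 1 (theta i)"
  by (simp add: deg_le_def theta.rep_eq mdeg_def)

lemma deg_le_xvar: "deg_le 1 (xvar i)"
  by (simp add: deg_le_def xvar.rep_eq mdeg_def)

lemma deg_le_xvar_power: "deg_le k (xvar i ^ k)"
  by (induction k) (use deg_le_times[OF deg_le_xvar] deg_le_1 in auto)

typedef sSym = "{f :: sps. (\<exists>d. deg_le d f) \<and> (\<forall>\<sigma>. bij \<sigma> \<longrightarrow> act \<sigma> f = f)}"
  by (rule exI[of _ 0]) (auto intro: deg_le_0 simp: act_zero)

setup_lifting type_definition_sSym

instantiation sSym :: ring_1
begin

lift_definition zero_sSym :: sSym is 0 by (auto intro: deg_le_0 simp: act_zero)
lift_definition one_sSym :: sSym is 1 by (auto intro: deg_le_1 simp: act_one)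
lift_definition plus_sSym :: "sSym \<Rightarrow> sSym \<Rightarrow> sSym" is "(+)"
  by (auto intro: deg_le_add simp: act_add)
lift_definition minus_sSym :: "sSym \<Rightarrow> sSym \<Rightarrow> sSym" is "(-)"
  by (auto intro: deg_le_minus simp: act_minus)
lift_definition uminus_sSym :: "sSym \<Rightarrow> sSym" is uminus
  by (auto intro: deg_le_uminus simp: act_uminus)
lift_definition times_sSym :: "sSym \<Rightarrow> sSym \<Rightarrow> sSym" is "(*)"
  by (auto intro: deg_le_times simp: act_mult)

instance
proof
  fix f g h :: sSym
  note rep = Rep_sSym_inject[symmetric] zero_sSym.rep_eq one_sSym.rep_eq
      plus_sSym.rep_eq minus_sSym.rep_eq uminus_sSym.rep_eq times_sSym.rep_eq
  show "f * g * h = f * (g * h)" by (simp only: rep mult.assoc)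
  show "f + g + h = f + (g + h)" by (simp only: rep add.assoc)
  show "f + g = g + f" by (simp only: rep add.commute)
  show "0 + f = f" by (simp only: rep add_0)
  show "- f + f = 0" by (simp only: rep left_minus)
  show "f - g = f + - g" by (simp only: rep diff_conv_add_uminus)
  show "1 * f = f" by (simp only: rep mult_1_left)
  show "f * 1 = f" by (simp only: rep mult_1_right)
  show "(f + g) * h = f * h + g * h" by (simp only: rep distrib_right)
  show "f * (g + h) = f * g + f * h" by (simp only: rep distrib_left)
  show "(0::sSym) \<noteq> 1" by (simp add: rep)
qed

end

lift_definition scaleQ :: "rat \<Rightarrow> sSym \<Rightarrow> sSym" is qscale
  by (auto intro: deg_le_scale simp: act_scale)

lemma vector_space_scaleQ: "vector_space scaleQ"
proof
  fix a b :: rat and f g :: sSym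
  show "scaleQ a (f + g) = scaleQ a f + scaleQ a g"
    by transfer (rule sps_eqI, simp add: coeff_simps algebra_simps)
  show "scaleQ (a + b) f = scaleQ a f + scaleQ b f"
    by transfer (rule sps_eqI, simp add: coeff_simps algebra_simps)
  show "scaleQ a (scaleQ b f) = scaleQ (a * b) f"
    by transfer (rule sps_eqI, simp add: coeff_simps algebra_simps)
  show "scaleQ 1 f = f"
    by transfer (rule sps_eqI, simp add: coeff_simps algebra_simps)
qed

lemma scaleQ_mult:
  "scaleQ a f * g = scaleQ a (f * g)" "f * scaleQ a g = scaleQ a (f * g)"
  by (transfer, rule sps_eqI, simp add: coeff_simps coeff_times' sum_distrib_left mult_ac)+

subsection \<open>Infinite sums\<close>

text \<open>
  \<open>lfsum I F\<close> is only meaningful when \<open>F\<close> is locally finite on \<open>I\<close>; this is shown for each use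
  below (\<open>locally_finite_mterms\<close>, \<open>locally_finite_pt\<close>).
\<close>

lift_definition lfsum :: "'i set \<Rightarrow> ('i \<Rightarrow> sps) \<Rightarrow> sps" is
  "\<lambda>I F M. \<Sum>i\<in>{i\<in>I. F i M \<noteq> 0}. F i M"
  by (auto intro: sum.neutral)

definition locally_finite :: "'i set \<Rightarrow> ('i \<Rightarrow> sps) \<Rightarrow> bool" where
  "locally_finite I F \<longleftrightarrow> (\<forall>M. finite {i\<in>I. coeff (F i) M \<noteq> 0})"

lemma act_lfsum:
  assumes "bij \<sigma>" shows "act \<sigma> (lfsum I F) = lfsum I (\<lambda>i. act \<sigma> (F i))"
  by (rule sps_eqI) (simp add: coeff_act[OF assms] lfsum.rep_eq sum_distrib_left psgn_nz)

lemma lfsum_reindex: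
  assumes "inj_on g I" shows "lfsum (g ` I) F = lfsum I (\<lambda>i. F (g i))"
proof (rule sps_eqI)
  fix M
  have "{j \<in> g ` I. coeff (F j) M \<noteq> 0} = g ` {i \<in> I. coeff (F (g i)) M \<noteq> 0}" by auto
  moreover have "inj_on g {i \<in> I. coeff (F (g i)) M \<noteq> 0}"
    using assms by (auto simp: inj_on_def)
  ultimately show "coeff (lfsum (g ` I) F) M = coeff (lfsum I (\<lambda>i. F (g i))) M"
    by (simp add: lfsum.rep_eq sum.reindex)
qed

lemma deg_le_lfsum:
  assumes "\<And>i. i \<in> I \<Longrightarrow> deg_le d (F i)" shows "deg_le d (lfsum I F)"
  unfolding deg_le_def
proof (intro allI impI)
  fix M assume "coeff (lfsum I F) M \<noteq> 0"
  moreover have "coeff (lfsum I F) M = 0" if "{i\<in>I. coeff (F i) M \<noteq> 0} = {}"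
    unfolding lfsum.rep_eq that by (rule sum.empty)
  ultimately have "{i\<in>I. coeff (F i) M \<noteq> 0} \<noteq> {}" by blast
  then obtain i where "i \<in> I" "coeff (F i) M \<noteq> 0" by blast
  then show "mdeg M \<le> d" using assms by (blast intro: deg_leD)
qed

lemma act_power: "bij \<sigma> \<Longrightarrow> act \<sigma> (f ^ k) = act \<sigma> f ^ k"
  by (induction k) (simp_all add: act_one act_mult)

lemma act_prod_list: "bij \<sigma> \<Longrightarrow> act \<sigma> (prod_list fs) = prod_list (map (act \<sigma>) fs)"
  by (induction fs) (simp_all add: act_one act_mult)

subsection \<open>Superpartitions, monomial functions and their relatives\<close>

type_synonym spart = "nat list \<times> nat list"

definition superpartition :: "spart \<Rightarrow> bool" where
  "superpartition \<Lambda> \<longleftrightarrow>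
     sorted_wrt (>) (fst \<Lambda>) \<and> sorted_wrt (\<ge>) (snd \<Lambda>) \<and> (\<forall>k\<in>set (snd \<Lambda>). 1 \<le> k)"

definition df :: "spart \<Rightarrow> nat" where "df \<Lambda> = length (fst \<Lambda>)"

definition psize :: "spart \<Rightarrow> nat" where "psize \<Lambda> = sum_list (fst \<Lambda>) + sum_list (snd \<Lambda>)"

text \<open>\<open>mterm \<Lambda> ix = \<theta>\<^bsub>i\<^sub>1\<^esub> \<cdots> \<theta>\<^bsub>i\<^sub>m\<^esub> x\<^bsub>i\<^sub>1\<^esub>\<^bsup>\<Lambda>\<^sub>1\<^esup> \<cdots> x\<^bsub>i\<^sub>n\<^esub>\<^bsup>\<Lambda>\<^sub>n\<^esup>\<close>\<close>

definition mterm :: "spart \<Rightarrow> nat list \<Rightarrow> sps" where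
  "mterm \<Lambda> ix = prod_list (map theta (take (df \<Lambda>) ix))
     * prod_list (map2 (\<lambda>i k. xvar i ^ k) ix (fst \<Lambda> @ snd \<Lambda>))"

text \<open>A set, so that each distinct term is summed once.\<close>

definition mterms :: "spart \<Rightarrow> sps set" where
  "mterms \<Lambda> = {mterm \<Lambda> ix | ix. length ix = length (fst \<Lambda> @ snd \<Lambda>) \<and> distinct ix}"

lemma act_mterm: "bij \<sigma> \<Longrightarrow> act \<sigma> (mterm \<Lambda> ix) = mterm \<Lambda> (map \<sigma> ix)"
proof -
  assume \<sigma>: "bij \<sigma>"
  have "map (act \<sigma>) (map2 (\<lambda>i k. xvar i ^ k) ix ks) = map2 (\<lambda>i k. xvar i ^ k) (map \<sigma> ix) ks" for ks
    using \<sigma> by (induction ix ks rule: list_induct2') (simp_all add: act_power act_xvar)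
  then show ?thesis
    using \<sigma> by (simp add: mterm_def act_mult act_prod_list take_map act_theta o_def)
qed

lemma act_mterms:
  assumes \<sigma>: "bij \<sigma>" shows "act \<sigma> ` mterms \<Lambda> = mterms \<Lambda>"
proof -
  have mem: "mterm \<Lambda> (map \<tau> ix) \<in> mterms \<Lambda>"
    if "inj \<tau>" "length ix = length (fst \<Lambda> @ snd \<Lambda>)" "distinct ix" for \<tau> ix
    unfolding mterms_def
    by (intro CollectI exI[of _ "map \<tau> ix"]) (use that in \<open>simp add: distinct_map inj_on_subset[of _ UNIV]\<close>)
  show ?thesis
  proof (intro equalityI subsetI)
    fix t assume "t \<in> act \<sigma> ` mterms \<Lambda>"
    then obtain ix where t: "t = act \<sigma> (mterm \<Lambda> ix)" "length ix = length (fst \<Lambda> @ snd \<Lambda>)" "distinct ix"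
      unfolding mterms_def by blast
    show "t \<in> mterms \<Lambda>"
      unfolding t(1) act_mterm[OF \<sigma>] by (rule mem[OF bij_is_inj[OF \<sigma>] t(2,3)])
  next
    fix t assume "t \<in> mterms \<Lambda>"
    then obtain js where t: "t = mterm \<Lambda> js" "length js = length (fst \<Lambda> @ snd \<Lambda>)" "distinct js"
      unfolding mterms_def by blast
    have "map \<sigma> (map (inv \<sigma>) js) = js"
      using \<sigma> by (simp add: o_def bij_is_surj surj_f_inv_f)
    then have "t = act \<sigma> (mterm \<Lambda> (map (inv \<sigma>) js))"
      unfolding act_mterm[OF \<sigma>] t(1) by simp
    moreover have "mterm \<Lambda> (map (inv \<sigma>) js) \<in> mterms \<Lambda>"
      by (rule mem[OF surj_imp_inj_inv[OF bij_is_surj[OF \<sigma>]] t(2,3)])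
    ultimately show "t \<in> act \<sigma> ` mterms \<Lambda>" by blast
  qed
qed

lemma deg_le_mterm: "deg_le (length ix + sum_list (fst \<Lambda> @ snd \<Lambda>)) (mterm \<Lambda> ix)"
proof -
  have "deg_le (length js) (prod_list (map theta js))" for js
    by (induction js) (use deg_le_1 deg_le_times[OF deg_le_theta] in auto)
  moreover have "deg_le (sum_list ks) (prod_list (map2 (\<lambda>i k. xvar i ^ k) js ks))" for ks js
    by (induction js ks rule: list_induct2')
       (auto intro: deg_le_mono[OF deg_le_1] deg_le_times[OF deg_le_xvar_power])
  ultimately have "deg_le (length (take (df \<Lambda>) ix) + sum_list (fst \<Lambda> @ snd \<Lambda>)) (mterm \<Lambda> ix)"
    unfolding mterm_def by (rule deg_le_times)
  then show ?thesis by (rule deg_le_mono) simp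
qed

lift_definition mono_fun :: "spart \<Rightarrow> sSym" is "\<lambda>\<Lambda>. lfsum (mterms \<Lambda>) (\<lambda>t. t)"
proof (intro CollectI conjI allI impI)
  fix \<Lambda> :: spart
  have "deg_le (length (fst \<Lambda> @ snd \<Lambda>) + sum_list (fst \<Lambda> @ snd \<Lambda>)) (lfsum (mterms \<Lambda>) (\<lambda>t. t))"
  proof (rule deg_le_lfsum)
    fix t assume "t \<in> mterms \<Lambda>"
    then obtain ix where "t = mterm \<Lambda> ix" "length ix = length (fst \<Lambda> @ snd \<Lambda>)"
      by (auto simp: mterms_def)
    then show "deg_le (length (fst \<Lambda> @ snd \<Lambda>) + sum_list (fst \<Lambda> @ snd \<Lambda>)) t"
      using deg_le_mterm[of ix \<Lambda>] by simp
  qed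
  then show "\<exists>d. deg_le d (lfsum (mterms \<Lambda>) (\<lambda>t. t))" ..
  fix \<sigma> :: "nat \<Rightarrow> nat" assume \<sigma>: "bij \<sigma>"
  have "act \<sigma> (lfsum (mterms \<Lambda>) (\<lambda>t. t)) = lfsum (mterms \<Lambda>) (\<lambda>t. act \<sigma> t)"
    by (rule act_lfsum[OF \<sigma>])
  also have "\<dots> = lfsum (act \<sigma> ` mterms \<Lambda>) (\<lambda>t. t)"
    by (rule lfsum_reindex[symmetric]) (auto intro: inj_onI act_inj[OF \<sigma>])
  finally show "act \<sigma> (lfsum (mterms \<Lambda>) (\<lambda>t. t)) = lfsum (mterms \<Lambda>) (\<lambda>t. t)"
    by (simp add: act_mterms[OF \<sigma>])
qed

definition h_sym :: "nat \<Rightarrow> sSym" where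
  "h_sym r = (\<Sum>\<Lambda>\<in>{\<Lambda>. superpartition \<Lambda> \<and> psize \<Lambda> = r \<and> df \<Lambda> = 0}. mono_fun \<Lambda>)"

definition e_sym :: "nat \<Rightarrow> sSym" where
  "e_sym r = (if r = 0 then 1 else mono_fun ([], replicate r 1))"

definition ht_sym :: "nat \<Rightarrow> sSym" where
  "ht_sym k = (\<Sum>\<Lambda>\<in>{\<Lambda>. superpartition \<Lambda> \<and> psize \<Lambda> = k \<and> df \<Lambda> = 1}.
     of_nat (hd (fst \<Lambda>) + 1) * mono_fun \<Lambda>)"

lift_definition pt_sym :: "nat \<Rightarrow> sSym" is "\<lambda>k. lfsum UNIV (\<lambda>i. theta i * xvar i ^ k)"
proof (intro CollectI conjI allI impI)
  fix k :: nat
  have "deg_le (1 + k) (lfsum UNIV (\<lambda>i. theta i * xvar i ^ k))"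
    by (rule deg_le_lfsum, rule deg_le_times[OF deg_le_theta deg_le_xvar_power])
  then show "\<exists>d. deg_le d (lfsum UNIV (\<lambda>i. theta i * xvar i ^ k))" ..
  fix \<sigma> :: "nat \<Rightarrow> nat" assume \<sigma>: "bij \<sigma>"
  have "act \<sigma> (lfsum UNIV (\<lambda>i. theta i * xvar i ^ k)) = lfsum UNIV (\<lambda>i. theta (\<sigma> i) * xvar (\<sigma> i) ^ k)"
    by (simp add: act_lfsum[OF \<sigma>] act_mult[OF \<sigma>] act_theta[OF \<sigma>] act_power[OF \<sigma>] act_xvar[OF \<sigma>])
  also have "\<dots> = lfsum (\<sigma> ` UNIV) (\<lambda>i. theta i * xvar i ^ k)"
    by (rule lfsum_reindex[symmetric]) (rule bij_is_inj[OF \<sigma>])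
  finally show "act \<sigma> (lfsum UNIV (\<lambda>i. theta i * xvar i ^ k)) = lfsum UNIV (\<lambda>i. theta i * xvar i ^ k)"
    by (simp add: bij_is_surj[OF \<sigma>])
qed


text \<open>
  The relations between the variables, local finiteness of the infinite sums above, and finiteness
  of the index sets of \<open>h_sym\<close> and \<open>ht_sym\<close>.
\<close>

definition monom :: "rat \<Rightarrow> smon \<Rightarrow> sps \<Rightarrow> bool" where
  "monom c M f \<longleftrightarrow> (\<forall>N. coeff f N = (if N = M then c else 0))"

lemma monomD: "monom c M f \<Longrightarrow> coeff f N = (if N = M then c else 0)"
  unfolding monom_def by blast

lemma monom_times:
  assumes f: "monom c P f" and g: "monom d Q g"
    and fin: "finite (fst P)" "finite (fst Q)"
  shows "monom (if fst P \<inter> fst Q = {} then ksgn (fst P) (fst Q) * c * d else 0)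
    (fst P \<union> fst Q, snd P + snd Q) (f * g)"
  unfolding monom_def
proof
  fix N :: smon
  let ?r = "if fst P \<inter> fst Q = {} then ksgn (fst P) (fst Q) * c * d else 0"
  show "coeff (f * g) N = (if N = (fst P \<union> fst Q, snd P + snd Q) then ?r else 0)"
  proof (cases "finite (fst N)")
    case False
    then have "N \<noteq> (fst P \<union> fst Q, snd P + snd Q)" using fin by auto
    with False show ?thesis by simp
  next
    case True
    have "coeff (f * g) N = (\<Sum>z\<in>decs N. if z = (P, Q) then ksgn (fst P) (fst Q) * c * d else 0)"
      unfolding coeff_times'
    proof (rule sum.cong[OF refl])
      fix z
      show "ksgn (fst (fst z)) (fst (snd z)) * coeff f (fst z) * coeff g (snd z)
        = (if z = (P, Q) then ksgn (fst P) (fst Q) * c * d else 0)"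
        unfolding monomD[OF f] monomD[OF g] by (cases z) auto
    qed
    also have "\<dots> = (if (P, Q) \<in> decs N then ksgn (fst P) (fst Q) * c * d else 0)"
      using True by simp
    also have "(P, Q) \<in> decs N \<longleftrightarrow> fst P \<inter> fst Q = {} \<and> N = (fst P \<union> fst Q, snd P + snd Q)"
      by (cases N) (auto simp: decs_def)
    finally show ?thesis by simp
  qed
qed

lemma monom_eqI: "monom c M f \<Longrightarrow> monom c M g \<Longrightarrow> f = g"
  by (rule sps_eqI) (simp add: monomD)

lemma monom_theta: "monom 1 ({i}, 0) (theta i)"
  by (simp add: monom_def theta.rep_eq)

lemma monom_xvar: "monom 1 ({}, Poly_Mapping.single i 1) (xvar i)"
  by (simp add: monom_def xvar.rep_eq)

lemma monom_one: "monom 1 ({}, 0) 1"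
  by (simp add: monom_def one_sps.rep_eq)

lemma ksgn_singleton: "ksgn {i} {j} = (if j < i then - 1 else 1)"
proof -
  have "{(s, t). s \<in> {i} \<and> t \<in> {j} \<and> t < s} = (if j < i then {(i, j)} else {})" by auto
  then show ?thesis unfolding ksgn_def by simp
qed

lemma coeff_theta_theta:
  "coeff (theta i * theta j) N = (if N = ({i, j}, 0) \<and> i \<noteq> j then ksgn {i} {j} else 0)"
  using monom_times[OF monom_theta monom_theta, of i j] by (auto dest!: monomD[where N = N])

lemma theta_anticommute: "theta i * theta j = - (theta j * theta i)"
  by (rule sps_eqI)
     (simp add: coeff_theta_theta uminus_sps.rep_eq ksgn_singleton insert_commute not_less)

lemma theta_square: "theta i * theta i = 0"
  by (rule sps_eqI) (simp add: coeff_theta_theta zero_sps.rep_eq)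

lemma xvar_commute: "xvar i * xvar j = xvar j * xvar i"
proof -
  have "monom 1 ({}, Poly_Mapping.single i 1 + Poly_Mapping.single j 1) (xvar i * xvar j)" for i j
    using monom_times[OF monom_xvar monom_xvar, of i j] by simp
  from this[of i j] this[of j i] show ?thesis
    by (simp add: add.commute monom_eqI)
qed

lemma theta_xvar_commute: "theta i * xvar j = xvar j * theta i"
proof -
  have "monom 1 ({i}, Poly_Mapping.single j 1) (theta i * xvar j)"
    using monom_times[OF monom_theta monom_xvar, of i j] by simp
  moreover have "monom 1 ({i}, Poly_Mapping.single j 1) (xvar j * theta i)"
    using monom_times[OF monom_xvar monom_theta, of j i] by simp
  ultimately show ?thesis by (rule monom_eqI)
qed


definition sgnmon :: "sps \<Rightarrow> bool" where
  "sgnmon f \<longleftrightarrow> (\<exists>c M. c \<in> {- 1, 0, 1} \<and> finite (fst M) \<and> monom c M f)"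

lemma sgnmon_times: assumes "sgnmon f" "sgnmon g" shows "sgnmon (f * g)"
proof -
  obtain c P d Q where *: "c \<in> {- 1, 0, 1}" "finite (fst P)" "monom c P f"
    "d \<in> {- 1, 0, 1}" "finite (fst Q)" "monom d Q g"
    using assms unfolding sgnmon_def by blast
  let ?r = "if fst P \<inter> fst Q = {} then ksgn (fst P) (fst Q) * c * d else 0"
  let ?M = "(fst P \<union> fst Q, snd P + snd Q)"
  have "ksgn (fst P) (fst Q) = 1 \<or> ksgn (fst P) (fst Q) = - 1"
    by (simp add: ksgn_def minus_one_power_iff)
  then have "?r \<in> {- 1, 0, 1}" using *(1,4) by (elim disjE) auto
  moreover have "finite (fst ?M)" using * by simp
  moreover have "monom ?r ?M (f * g)" by (rule monom_times[OF *(3,6,2,5)])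
  ultimately show ?thesis unfolding sgnmon_def by blast
qed

lemma sgnmon_one: "sgnmon 1"
  using monom_one unfolding sgnmon_def by (intro exI[of _ 1] exI[of _ "({}, 0)"]) simp

lemma sgnmon_theta: "sgnmon (theta i)"
  using monom_theta unfolding sgnmon_def by (intro exI[of _ 1] exI[of _ "({i}, 0)"]) simp

lemma sgnmon_xvar: "sgnmon (xvar i)"
  using monom_xvar unfolding sgnmon_def
  by (intro exI[of _ 1] exI[of _ "({}, Poly_Mapping.single i 1)"]) simp

lemma sgnmon_power: "sgnmon f \<Longrightarrow> sgnmon (f ^ k)"
  by (induction k) (auto intro: sgnmon_one sgnmon_times)

lemma sgnmon_prod_list: "(\<And>f. f \<in> set fs \<Longrightarrow> sgnmon f) \<Longrightarrow> sgnmon (prod_list fs)"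
  by (induction fs) (auto intro: sgnmon_one sgnmon_times)

lemma locally_finite_mterms: "locally_finite (mterms \<Lambda>) (\<lambda>t. t)"
  unfolding locally_finite_def
proof
  fix M
  have fin: "finite {f. monom c M f}" for c
  proof (cases "\<exists>f. monom c M f")
    case True
    then obtain f where "monom c M f" ..
    then have "{f. monom c M f} \<subseteq> {f}" using monom_eqI by blast
    then show ?thesis by (rule finite_subset) simp
  qed simp
  have "{t \<in> mterms \<Lambda>. coeff t M \<noteq> 0} \<subseteq> {f. monom 1 M f} \<union> {f. monom (- 1) M f}"
  proof
    fix t assume "t \<in> {t \<in> mterms \<Lambda>. coeff t M \<noteq> 0}"
    then obtain ix where t: "t = mterm \<Lambda> ix" and nz: "coeff t M \<noteq> 0"
      unfolding mterms_def by blast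
    have "sgnmon t"
      unfolding t mterm_def
      by (intro sgnmon_times sgnmon_prod_list) (auto intro: sgnmon_theta sgnmon_power sgnmon_xvar)
    then obtain c N where c: "c \<in> {- 1, 0, 1}" "monom c N t" unfolding sgnmon_def by blast
    have "N = M" using nz monomD[OF c(2), of M] by (metis (full_types))
    moreover have "c \<noteq> 0" using nz monomD[OF c(2), of M] by (metis (full_types))
    ultimately show "t \<in> {f. monom 1 M f} \<union> {f. monom (- 1) M f}" using c by auto
  qed
  then show "finite {t \<in> mterms \<Lambda>. coeff t M \<noteq> 0}"
    by (rule finite_subset) (simp add: fin)
qed

lemma monom_xvar_power: "monom 1 ({}, Poly_Mapping.single i k) (xvar i ^ k)"
proof (induction k)
  case 0
  then show ?case using monom_one by simp
next
  case (Suc k)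
  from monom_times[OF monom_xvar this, of i]
  show ?case by (simp add: single_add[symmetric])
qed

lemma locally_finite_pt: "locally_finite UNIV (\<lambda>i. theta i * xvar i ^ k)"
  unfolding locally_finite_def
proof
  fix M
  have "monom 1 ({i}, Poly_Mapping.single i k) (theta i * xvar i ^ k)" for i
    using monom_times[OF monom_theta monom_xvar_power, of i i k] by simp
  then have *: "coeff (theta i * xvar i ^ k) M \<noteq> 0 \<Longrightarrow> M = ({i}, Poly_Mapping.single i k)" for i
    using monomD by (metis (full_types))
  have "{i \<in> UNIV. coeff (theta i * xvar i ^ k) M \<noteq> 0} \<subseteq> {the_elem (fst M)}"
  proof
    fix i assume "i \<in> {i \<in> UNIV. coeff (theta i * xvar i ^ k) M \<noteq> 0}"
    then have "M = ({i}, Poly_Mapping.single i k)" using * by blast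
    then show "i \<in> {the_elem (fst M)}" by simp
  qed
  then show "finite {i \<in> UNIV. coeff (theta i * xvar i ^ k) M \<noteq> 0}"
    by (rule finite_subset) simp
qed

lemma finite_superpartitions: "finite {\<Lambda>. superpartition \<Lambda> \<and> psize \<Lambda> = r \<and> df \<Lambda> = d}"
proof -
  have len: "length ks \<le> sum_list ks" if "\<forall>k\<in>set ks. 1 \<le> k" for ks :: "nat list"
    using that by (induction ks) force+
  have "{\<Lambda>. superpartition \<Lambda> \<and> psize \<Lambda> = r \<and> df \<Lambda> = d} \<subseteq>
     {ks. set ks \<subseteq> {..r} \<and> length ks \<le> d} \<times> {ks. set ks \<subseteq> {..r} \<and> length ks \<le> r}"
  proof
    fix \<Lambda> assume "\<Lambda> \<in> {\<Lambda>. superpartition \<Lambda> \<and> psize \<Lambda> = r \<and> df \<Lambda> = d}"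
    then obtain as bs where *: "\<Lambda> = (as, bs)" "superpartition (as, bs)"
      "r = sum_list as + sum_list bs" "d = length as"
      by (cases \<Lambda>) (auto simp: psize_def df_def)
    have "k \<le> r" if "k \<in> set as \<or> k \<in> set bs" for k
      using that member_le_sum_list[of k as] member_le_sum_list[of k bs] unfolding *(3) by auto
    moreover have "length bs \<le> r"
      using len[of bs] *(2,3) by (auto simp: superpartition_def)
    ultimately show "\<Lambda> \<in> {ks. set ks \<subseteq> {..r} \<and> length ks \<le> d} \<times> {ks. set ks \<subseteq> {..r} \<and> length ks \<le> r}"
      using *(1,4) by auto
  qed
  then show ?thesis
    by (rule finite_subset) (intro finite_cartesian_product finite_lists_length_le; simp)
qed

section \<open>Dotted compositions and noncommutative symmetric functions in superspace\<close>

typedef pnat = "{n :: nat. 1 \<le> n}" morphisms nat_of pnat_of by auto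

setup_lifting type_definition_pnat

instantiation pnat :: "{one, plus}"
begin
lift_definition one_pnat :: pnat is 1 by simp
lift_definition plus_pnat :: "pnat \<Rightarrow> pnat \<Rightarrow> pnat" is "(+)" by simp
instance ..
end

datatype entry = Plain pnat | Dot nat

type_synonym dcomp = "entry list"

fun dotted :: "entry \<Rightarrow> bool" where
  "dotted (Plain m) = False"
| "dotted (Dot n) = True"

text \<open>The sum of two dotted entries is left unspecified; it is never used.\<close>

fun osum :: "entry \<Rightarrow> entry \<Rightarrow> entry" where
  "osum (Plain m) (Plain n) = Plain (m + n)"
| "osum (Plain m) (Dot n) = Dot (nat_of m + n)"
| "osum (Dot m) (Plain n) = Dot (m + nat_of n)"

definition merge1 :: "dcomp \<Rightarrow> dcomp \<Rightarrow> bool" where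
  "merge1 \<alpha> \<beta> \<longleftrightarrow> (\<exists>us x y vs. \<alpha> = us @ [x, y] @ vs \<and> \<not> (dotted x \<and> dotted y)
     \<and> \<beta> = us @ [osum x y] @ vs)"

definition dle :: "dcomp \<Rightarrow> dcomp \<Rightarrow> bool" where "dle = merge1\<^sup>*\<^sup>*"

definition dless :: "dcomp \<Rightarrow> dcomp \<Rightarrow> bool" where "dless \<alpha> \<beta> \<longleftrightarrow> dle \<alpha> \<beta> \<and> \<alpha> \<noteq> \<beta>"

lemma merge1_length: "merge1 \<alpha> \<beta> \<Longrightarrow> length \<alpha> = Suc (length \<beta>)"
  by (auto simp: merge1_def)

lemma dle_length: "dle \<alpha> \<beta> \<Longrightarrow> \<alpha> = \<beta> \<or> length \<beta> < length \<alpha>"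
  unfolding dle_def by (induction rule: rtranclp_induct) (use merge1_length in fastforce)+

lemma dless_length: "dless \<alpha> \<beta> \<Longrightarrow> length \<beta> < length \<alpha>"
  using dle_length by (auto simp: dless_def)

lemma finite_merge1: "finite {\<beta>. merge1 \<alpha> \<beta>}"
proof (rule finite_subset)
  show "{\<beta>. merge1 \<alpha> \<beta>} \<subseteq>
      (\<lambda>i. take i \<alpha> @ [osum (\<alpha> ! i) (\<alpha> ! Suc i)] @ drop (Suc (Suc i)) \<alpha>) ` {..<length \<alpha>}"
  proof
    fix \<beta> assume "\<beta> \<in> {\<beta>. merge1 \<alpha> \<beta>}"
    then obtain us x y vs where *: "\<alpha> = us @ [x, y] @ vs" "\<beta> = us @ [osum x y] @ vs"
      unfolding merge1_def by blast
    then have "\<beta> = take (length us) \<alpha> @ [osum (\<alpha> ! length us) (\<alpha> ! Suc (length us))]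
        @ drop (Suc (Suc (length us))) \<alpha>"
      by (simp add: nth_append)
    moreover have "length us < length \<alpha>" using * by simp
    ultimately show "\<beta> \<in> (\<lambda>i. take i \<alpha> @ [osum (\<alpha> ! i) (\<alpha> ! Suc i)] @ drop (Suc (Suc i)) \<alpha>) ` {..<length \<alpha>}"
      by blast
  qed
qed simp

lemma finite_dle: "finite {\<beta>. dle \<alpha> \<beta>}"
proof (induction \<alpha> rule: length_induct)
  case (1 \<alpha>)
  have "{\<beta>. dle \<alpha> \<beta>} \<subseteq> insert \<alpha> (\<Union>\<gamma>\<in>{\<gamma>. merge1 \<alpha> \<gamma>}. {\<beta>. dle \<gamma> \<beta>})"
    unfolding dle_def by (auto elim: converse_rtranclpE)
  moreover have "finite \<dots>"
    using 1 finite_merge1 merge1_length by (auto intro!: finite_UN_I)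
  ultimately show ?case by (rule finite_subset)
qed

lemma finite_dless: "finite {\<beta>. dless \<alpha> \<beta>}"
  by (rule finite_subset[OF _ finite_dle[of \<alpha>]]) (auto simp: dless_def)

text \<open>
  Words form the free monoid, written additively, so that \<open>\<Rightarrow>\<^sub>0\<close> with its convolution product is
  the monoid algebra: the free associative unital algebra on the letters.
\<close>

instantiation list :: (type) monoid_add
begin
definition zero_list :: "'a list" where "zero_list = []"
definition plus_list :: "'a list \<Rightarrow> 'a list \<Rightarrow> 'a list" where "plus_list = (@)"
instance by standard (simp_all add: zero_list_def plus_list_def)
end

type_synonym sNSym = "entry list \<Rightarrow>\<^sub>0 rat"

definition H_gen :: "entry \<Rightarrow> sNSym" where "H_gen x = Poly_Mapping.single [x] 1"

definition H_comp :: "dcomp \<Rightarrow> sNSym" where "H_comp \<alpha> = prod_list (map H_gen \<alpha>)"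

function R_comp :: "dcomp \<Rightarrow> sNSym" where
  "R_comp \<alpha> = H_comp \<alpha> - (\<Sum>\<beta>\<in>{\<beta>. dless \<alpha> \<beta>}. R_comp \<beta>)"
  by auto
termination by (relation "measure length") (auto dest: dless_length)

declare R_comp.simps [simp del]

fun pi_gen :: "entry \<Rightarrow> sSym" where
  "pi_gen (Plain n) = h_sym (nat_of n)"
| "pi_gen (Dot n) = ht_sym n"

definition pi_map :: "sNSym \<Rightarrow> sSym" where
  "pi_map f = (\<Sum>w\<in>Poly_Mapping.keys f. scaleQ (Poly_Mapping.lookup f w) (prod_list (map pi_gen w)))"

interpretation scaleQ: vector_space scaleQ by (rule vector_space_scaleQ)

lemma pi_map_superset:
  assumes "finite A" "Poly_Mapping.keys f \<subseteq> A"
  shows "pi_map f = (\<Sum>w\<in>A. scaleQ (Poly_Mapping.lookup f w) (prod_list (map pi_gen w)))"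
  unfolding pi_map_def
  by (rule sum.mono_neutral_left) (use assms in \<open>auto simp: in_keys_iff\<close>)

lemma pi_map_add: "pi_map (f + g) = pi_map f + pi_map g"
proof -
  let ?A = "Poly_Mapping.keys f \<union> Poly_Mapping.keys g"
  have "pi_map (f + g) = (\<Sum>w\<in>?A. scaleQ (Poly_Mapping.lookup (f + g) w) (prod_list (map pi_gen w)))"
    by (rule pi_map_superset) (simp_all add: Poly_Mapping.keys_add)
  also have "\<dots> = (\<Sum>w\<in>?A. scaleQ (Poly_Mapping.lookup f w) (prod_list (map pi_gen w)))
      + (\<Sum>w\<in>?A. scaleQ (Poly_Mapping.lookup g w) (prod_list (map pi_gen w)))"
    by (simp add: lookup_add scaleQ.scale_left_distrib sum.distrib)
  finally show ?thesis by (simp flip: pi_map_superset)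
qed

lemma pi_map_single: "pi_map (Poly_Mapping.single w c) = scaleQ c (prod_list (map pi_gen w))"
  by (subst pi_map_superset[of "{w}"]) auto

lemma pi_map_0: "pi_map 0 = 0"
  by (simp add: pi_map_def)

lemma pi_map_sum: "pi_map (\<Sum>i\<in>I. f i) = (\<Sum>i\<in>I. pi_map (f i))"
  by (induction I rule: infinite_finite_induct) (simp_all add: pi_map_0 pi_map_add)

lemma poly_mapping_sum_single:
  "f = (\<Sum>w\<in>Poly_Mapping.keys f. Poly_Mapping.single w (Poly_Mapping.lookup f w))"
proof (rule poly_mapping_eqI)
  fix k
  have "Poly_Mapping.lookup (\<Sum>w\<in>Poly_Mapping.keys f. Poly_Mapping.single w (Poly_Mapping.lookup f w)) k
     = (\<Sum>w\<in>Poly_Mapping.keys f. if w = k then Poly_Mapping.lookup f k else 0)"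
    unfolding lookup_sum by (rule sum.cong) (auto simp: lookup_single when_def)
  also have "\<dots> = Poly_Mapping.lookup f k" by (simp add: in_keys_iff)
  finally show "Poly_Mapping.lookup f k
     = Poly_Mapping.lookup (\<Sum>w\<in>Poly_Mapping.keys f. Poly_Mapping.single w (Poly_Mapping.lookup f w)) k" ..
qed

lemma pi_map_mult: "pi_map (f * g) = pi_map f * pi_map g"
proof -
  have *: "pi_map (Poly_Mapping.single u a * Poly_Mapping.single v b)
      = pi_map (Poly_Mapping.single u a) * pi_map (Poly_Mapping.single v b)" for u v a b
    by (simp add: mult_single pi_map_single plus_list_def scaleQ_mult)
  have "pi_map (f * g) = pi_map ((\<Sum>u\<in>Poly_Mapping.keys f. Poly_Mapping.single u (Poly_Mapping.lookup f u))
      * (\<Sum>v\<in>Poly_Mapping.keys g. Poly_Mapping.single v (Poly_Mapping.lookup g v)))"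
    by (simp flip: poly_mapping_sum_single)
  also have "\<dots> = pi_map (\<Sum>u\<in>Poly_Mapping.keys f. Poly_Mapping.single u (Poly_Mapping.lookup f u))
      * pi_map (\<Sum>v\<in>Poly_Mapping.keys g. Poly_Mapping.single v (Poly_Mapping.lookup g v))"
    unfolding sum_product pi_map_sum by (simp add: *)
  finally show ?thesis by (simp flip: poly_mapping_sum_single)
qed

lemma pi_map_one: "pi_map 1 = 1"
  unfolding single_one[symmetric] pi_map_single by (simp add: zero_list_def)

lemma pi_map_scale: "pi_map (Poly_Mapping.single 0 c * f) = scaleQ c (pi_map f)"
  by (simp add: pi_map_mult pi_map_single zero_list_def scaleQ_mult)

lemma pi_map_H_gen: "pi_map (H_gen (Plain n)) = h_sym (nat_of n)" "pi_map (H_gen (Dot k)) = ht_sym k"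
  by (simp_all add: H_gen_def pi_map_single)

definition r_comp :: "dcomp \<Rightarrow> sSym" where "r_comp \<alpha> = pi_map (R_comp \<alpha>)"

end

theory Submission
  imports Defs "HOL-Computational_Algebra.Formal_Power_Series"
begin

text \<open>
  All three identities compare generating functions in a central variable \<open>t\<close> over the
  noncommutative ring \<open>sSym\<close>. Write \<open>H\<close>, \<open>T\<close>, \<open>P\<close> for the series of the \<open>h\<^sub>n\<close>, of the
  fermionic complete functions \<open>ht_sym n\<close> and of the power sums \<open>pt_sym n\<close>, write \<open>E\<close> for the
  series of the \<open>(-1)\<^sup>n e\<^sub>n\<close>, and \<open>R\<close> for the series whose coefficient of \<open>t\<^sup>n\<close> is \<open>(-1)\<^sup>n r\<^sub>\<alpha>\<close> with
  \<open>\<alpha> = (1, \<dots>, 1, Dot 0)\<close> having \<open>n\<close> ones. Then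

    \<open>E H = 1\<close>,   \<open>H P = T\<close>,   \<open>H R = T\<close>.

  Multiplying the last two by \<open>E\<close> on the left gives \<open>P = R = E T\<close>, and reading off the coefficient
  of \<open>t\<^sup>n\<close> gives the theorem.

  The first two equations (\<open>e_times_h\<close>, \<open>h_times_pt\<close>) are checked monomial by monomial.
  A monomial \<open>x\<^sup>a\<close> of positive degree occurs in \<open>E H\<close> once, with sign \<open>(-1)\<close> to the number
  of elements, for every subset of its support, which adds up to \<open>0\<close>. A monomial \<open>\<theta>\<^sub>i x\<^sup>a\<close> arises in \<open>H P\<close>
  by splitting off a factor \<open>\<theta>\<^sub>i x\<^sub>i\<^sup>l\<close>, for which \<open>l\<close> ranges over \<open>0, \<dots>, a\<^sub>i\<close>; the \<open>a\<^sub>i + 1\<close> choices are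
  exactly the weight in the definition of \<open>ht_sym\<close>.

  The third equation comes from the product rule for ribbons (\<open>H_gen_times_R\<close>): \<open>H\<^sub>m R\<^sub>\<alpha>\<close> is the
  sum of the ribbons of \<open>(m, \<alpha>\<^sub>1, \<alpha>\<^sub>2, \<dots>)\<close> and of \<open>(m \<oplus> \<alpha>\<^sub>1, \<alpha>\<^sub>2, \<dots>)\<close>. Applied to the
  hooks \<open>(1, \<dots>, 1, Dot 0)\<close> with \<open>k\<close> ones, it makes the alternating sum over \<open>m + k = N\<close> telescope, leaving only the ribbon of
  the hook with \<open>N\<close> ones at one end and that of the single entry \<open>Dot N\<close> at the other.
\<close>

section \<open>Ribbon functions: products with a complete generator\<close>

text \<open>
  The near-concatenation of the one-entry composition \<open>m\<close> with \<open>\<alpha>\<close>. It is used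
  for nonempty \<open>\<alpha>\<close>, the value at the empty list being a junk value.
\<close>

definition absorb :: "pnat \<Rightarrow> dcomp \<Rightarrow> dcomp" where
  "absorb m \<alpha> = osum (Plain m) (hd \<alpha>) # tl \<alpha>"

lemma absorb_Cons [simp]: "absorb m (x # \<alpha>) = osum (Plain m) x # \<alpha>"
  by (simp add: absorb_def)

lemma pnat_add_assoc: "(a + b) + c = a + (b + c :: pnat)"
  by transfer simp

lemma pnat_add_left_cancel: "a + b = a + c \<longleftrightarrow> b = (c :: pnat)"
  by transfer simp

lemma pnat_add_neq: "m + n \<noteq> (m :: pnat)"
  by transfer simp

lemma dotted_osum_Plain [simp]: "dotted (osum (Plain m) x) = dotted x"
  by (cases x) auto

text \<open>
  Adding an undotted number does not change whether an entry is dotted, so the same mergers are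
  permitted before and after, and both orders of merging agree.
\<close>

lemma osum_Plain_assoc:
  "\<not> (dotted x \<and> dotted y) \<Longrightarrow> osum (osum (Plain m) x) y = osum (Plain m) (osum x y)"
  by (cases x; cases y) (auto simp: pnat_add_assoc plus_pnat.rep_eq)

lemma osum_Plain_inject: "osum (Plain m) x = osum (Plain m) y \<longleftrightarrow> x = y"
  by (cases x; cases y) (auto simp: pnat_add_left_cancel)

lemma osum_Plain_neq: "osum (Plain m) x \<noteq> Plain m"
  by (cases x) (auto simp: pnat_add_neq)

lemma merge1_Cons:
  "merge1 (x # \<alpha>) \<gamma> \<longleftrightarrow>
    (\<exists>\<beta>. merge1 \<alpha> \<beta> \<and> \<gamma> = x # \<beta>) \<or>
    (\<exists>y \<beta>. \<alpha> = y # \<beta> \<and> \<not> (dotted x \<and> dotted y) \<and> \<gamma> = osum x y # \<beta>)"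
  (is "?L \<longleftrightarrow> ?R")
proof
  assume ?L
  then obtain us u v vs where *: "x # \<alpha> = us @ [u, v] @ vs" "\<not> (dotted u \<and> dotted v)"
    "\<gamma> = us @ [osum u v] @ vs"
    unfolding merge1_def by blast
  show ?R
  proof (cases us)
    case Nil
    with * show ?thesis by auto
  next
    case (Cons w ws)
    with * have "merge1 \<alpha> (ws @ [osum u v] @ vs)" unfolding merge1_def by auto
    with Cons * show ?thesis by auto
  qed
next
  assume ?R
  then show ?L
  proof (elim disjE exE conjE)
    fix \<beta> assume "merge1 \<alpha> \<beta>" and \<gamma>: "\<gamma> = x # \<beta>"
    then obtain us u v vs where *: "\<alpha> = us @ [u, v] @ vs" "\<not> (dotted u \<and> dotted v)"
      "\<beta> = us @ [osum u v] @ vs"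
      unfolding merge1_def by blast
    then show ?L unfolding merge1_def \<gamma>
      by (intro exI[of _ "x # us"] exI[of _ u] exI[of _ v] exI[of _ vs]) simp
  next
    fix y \<beta> assume "\<alpha> = y # \<beta>" "\<not> (dotted x \<and> dotted y)" "\<gamma> = osum x y # \<beta>"
    then show ?L unfolding merge1_def
      by (intro exI[of _ "[]"] exI[of _ x] exI[of _ y] exI[of _ \<beta>]) simp
  qed
qed

lemma not_merge1_Nil [simp]: "\<not> merge1 [] \<gamma>" "\<not> merge1 \<alpha> []"
  by (auto simp: merge1_def)

lemma merge1_Plain_Cons:
  "\<alpha> \<noteq> [] \<Longrightarrow> merge1 (Plain m # \<alpha>) \<gamma> \<longleftrightarrow> (\<exists>\<beta>. merge1 \<alpha> \<beta> \<and> \<gamma> = Plain m # \<beta>) \<or> \<gamma> = absorb m \<alpha>"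
  by (cases \<alpha>) (auto simp: merge1_Cons[of "Plain m"])

lemma merge1_absorb:
  assumes "\<alpha> \<noteq> []"
  shows "merge1 (absorb m \<alpha>) \<gamma> \<longleftrightarrow> (\<exists>\<beta>. merge1 \<alpha> \<beta> \<and> \<gamma> = absorb m \<beta>)"
proof -
  obtain x \<alpha>' where \<alpha>: "\<alpha> = x # \<alpha>'" using assms by (cases \<alpha>) auto
  show ?thesis
    unfolding \<alpha> absorb_Cons merge1_Cons
    by (auto simp: osum_Plain_assoc)
qed

lemma dle_nonempty: "dle \<alpha> \<beta> \<Longrightarrow> \<alpha> \<noteq> [] \<Longrightarrow> \<beta> \<noteq> []"
  unfolding dle_def by (induction rule: rtranclp_induct) auto

lemma dle_refl: "dle \<alpha> \<alpha>"
  by (simp add: dle_def)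

lemma dle_step: "dle \<alpha> \<beta> \<Longrightarrow> merge1 \<beta> \<gamma> \<Longrightarrow> dle \<alpha> \<gamma>"
  unfolding dle_def by (rule rtranclp.rtrancl_into_rtrancl)

text \<open>
  A coarsening of \<open>(m, \<alpha>)\<close> either never merges \<open>m\<close> with its right neighbour or does so at some
  point. Since \<open>m\<close> is undotted, that merger is always permitted and may be postponed to the end, after
  all mergers inside \<open>\<alpha>\<close>; hence the coarsenings are indexed by two copies of those of \<open>\<alpha>\<close>.
\<close>

lemma dle_Plain_Cons:
  assumes "\<alpha> \<noteq> []"
  shows "{\<gamma>. dle (Plain m # \<alpha>) \<gamma>} = (#) (Plain m) ` {\<beta>. dle \<alpha> \<beta>} \<union> absorb m ` {\<beta>. dle \<alpha> \<beta>}"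
    (is "_ = ?C \<union> ?A")
proof (intro equalityI subsetI)
  fix \<gamma> assume "\<gamma> \<in> {\<gamma>. dle (Plain m # \<alpha>) \<gamma>}"
  then have "merge1\<^sup>*\<^sup>* (Plain m # \<alpha>) \<gamma>" by (simp add: dle_def)
  then show "\<gamma> \<in> ?C \<union> ?A"
  proof (induction rule: rtranclp_induct)
    case base
    then show ?case using dle_refl by auto
  next
    case (step \<beta> \<gamma>)
    then consider \<delta> where "dle \<alpha> \<delta>" "\<beta> = Plain m # \<delta>" | \<delta> where "dle \<alpha> \<delta>" "\<beta> = absorb m \<delta>"
      by auto
    then show ?case
    proof cases
      case 1
      with step(2) dle_nonempty[OF 1(1) assms] show ?thesis
        by (auto simp: merge1_Plain_Cons intro: dle_step)
    next
      case 2
      with step(2) dle_nonempty[OF 2(1) assms] show ?thesis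
        by (auto simp: merge1_absorb intro: dle_step)
    qed
  qed
next
  have C: "dle (Plain m # \<alpha>) (Plain m # \<beta>)" if "dle \<alpha> \<beta>" for \<beta>
    using that unfolding dle_def
  proof (induction rule: rtranclp_induct)
    case (step \<beta> \<gamma>)
    then have "merge1 (Plain m # \<beta>) (Plain m # \<gamma>)" by (auto simp: merge1_Cons)
    with step show ?case by (meson rtranclp.rtrancl_into_rtrancl)
  qed simp
  fix \<gamma> assume "\<gamma> \<in> ?C \<union> ?A"
  then consider \<beta> where "dle \<alpha> \<beta>" "\<gamma> = Plain m # \<beta>" | \<beta> where "dle \<alpha> \<beta>" "\<gamma> = absorb m \<beta>"
    by auto
  then show "\<gamma> \<in> {\<gamma>. dle (Plain m # \<alpha>) \<gamma>}"
  proof cases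
    case 2
    have "merge1 (Plain m # \<beta>) \<gamma>"
      using dle_nonempty[OF 2(1) assms] 2 by (simp add: merge1_Plain_Cons)
    with C[OF 2(1)] show ?thesis by (auto intro: dle_step)
  qed (use C in auto)
qed

lemma H_comp_eq_sum_R: "H_comp \<alpha> = (\<Sum>\<beta>\<in>{\<beta>. dle \<alpha> \<beta>}. R_comp \<beta>)"
proof -
  have "{\<beta>. dle \<alpha> \<beta>} = insert \<alpha> {\<beta>. dless \<alpha> \<beta>}"
    using dle_refl by (auto simp: dless_def)
  moreover have "\<alpha> \<notin> {\<beta>. dless \<alpha> \<beta>}" by (simp add: dless_def)
  ultimately show ?thesis
    using finite_dless[of \<alpha>] by (simp add: R_comp.simps[of \<alpha>])
qed

text \<open>
  The two copies of the coarsenings of \<open>\<alpha>\<close> do not overlap: adding an entry to \<open>m\<close> makes it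
  larger or dotted, so the first entry tells the copies apart.
\<close>

lemma sum_R_Plain_Cons:
  assumes "\<alpha> \<noteq> []"
  shows "H_comp (Plain m # \<alpha>) =
    (\<Sum>\<beta>\<in>{\<beta>. dle \<alpha> \<beta>}. R_comp (Plain m # \<beta>) + R_comp (absorb m \<beta>))"
proof -
  let ?U = "{\<beta>. dle \<alpha> \<beta>}"
  have ne: "\<beta> \<noteq> []" if "\<beta> \<in> ?U" for \<beta>
    using that dle_nonempty assms by auto
  have disj: "(#) (Plain m) ` ?U \<inter> absorb m ` ?U = {}"
    by (auto simp: absorb_def) (metis osum_Plain_neq)
  have inj: "inj_on (absorb m) ?U"
  proof (rule inj_onI)
    fix \<beta> \<gamma> assume "\<beta> \<in> ?U" "\<gamma> \<in> ?U" "absorb m \<beta> = absorb m \<gamma>"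
    then show "\<beta> = \<gamma>"
      using ne[of \<beta>] ne[of \<gamma>] by (cases \<beta>; cases \<gamma>) (simp_all add: osum_Plain_inject)
  qed
  have "H_comp (Plain m # \<alpha>) = (\<Sum>\<gamma>\<in>(#) (Plain m) ` ?U \<union> absorb m ` ?U. R_comp \<gamma>)"
    using H_comp_eq_sum_R[of "Plain m # \<alpha>"] unfolding dle_Plain_Cons[OF assms] .
  also have "\<dots> = (\<Sum>\<gamma>\<in>(#) (Plain m) ` ?U. R_comp \<gamma>) + (\<Sum>\<gamma>\<in>absorb m ` ?U. R_comp \<gamma>)"
    by (rule sum.union_disjoint) (use finite_dle disj in auto)
  also have "\<dots> = (\<Sum>\<beta>\<in>?U. R_comp (Plain m # \<beta>)) + (\<Sum>\<beta>\<in>?U. R_comp (absorb m \<beta>))"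
    by (simp add: sum.reindex inj)
  finally show ?thesis by (simp add: sum.distrib)
qed

text \<open>
  The product rule for ribbons. Expanding \<open>H\<^bsub>(m, \<alpha>)\<^esub> = H\<^sub>m H\<^sub>\<alpha>\<close> in ribbons in two ways, once as a
  whole and once only in the factor \<open>H\<^sub>\<alpha>\<close>, gives the sum of this rule over all coarsenings of \<open>\<alpha>\<close>. The
  proper coarsenings are shorter, and their terms cancel by induction.
\<close>

lemma H_gen_times_R:
  "\<alpha> \<noteq> [] \<Longrightarrow> H_gen (Plain m) * R_comp \<alpha> = R_comp (Plain m # \<alpha>) + R_comp (absorb m \<alpha>)"
proof (induction \<alpha> rule: length_induct)
  case (1 \<alpha>)
  let ?D = "{\<beta>. dless \<alpha> \<beta>}" and ?F = "\<lambda>\<beta>. R_comp (Plain m # \<beta>) + R_comp (absorb m \<beta>)"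
  have U: "{\<beta>. dle \<alpha> \<beta>} = insert \<alpha> ?D"
    using dle_refl by (auto simp: dless_def)
  have nin: "\<alpha> \<notin> ?D" by (simp add: dless_def)
  have IH: "H_gen (Plain m) * R_comp \<beta> = ?F \<beta>" if "\<beta> \<in> ?D" for \<beta>
    using that 1 dle_nonempty[of \<alpha> \<beta>] dless_length[of \<alpha> \<beta>] by (auto simp: dless_def)
  have "H_gen (Plain m) * R_comp \<alpha> + (\<Sum>\<beta>\<in>?D. ?F \<beta>) = H_gen (Plain m) * (\<Sum>\<beta>\<in>insert \<alpha> ?D. R_comp \<beta>)"
    using nin finite_dless[of \<alpha>] by (simp add: distrib_left sum_distrib_left IH)
  also have "\<dots> = H_comp (Plain m # \<alpha>)"
    unfolding U[symmetric] H_comp_eq_sum_R[symmetric] by (simp add: H_comp_def)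
  also have "\<dots> = ?F \<alpha> + (\<Sum>\<beta>\<in>?D. ?F \<beta>)"
    unfolding sum_R_Plain_Cons[OF 1(2)] U using nin finite_dless[of \<alpha>] by simp
  finally show ?case by simp
qed

section \<open>A recursion for the ribbons of hook shape\<close>

lemma sign_central: "(f :: 'a::ring_1) * ((- 1) ^ n * g) = (- 1) ^ n * (f * g)"
  by (cases "even n") auto

abbreviation hook :: "nat \<Rightarrow> dcomp" where
  "hook n \<equiv> replicate n (Plain 1) @ [Dot 0]"

lemma h_times_r:
  "\<alpha> \<noteq> [] \<Longrightarrow> h_sym (nat_of m) * r_comp \<alpha> = r_comp (Plain m # \<alpha>) + r_comp (absorb m \<alpha>)"
  using arg_cong[OF H_gen_times_R[of \<alpha> m], of pi_map]
  by (simp add: r_comp_def pi_map_mult pi_map_add pi_map_H_gen)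

lemma r_Dot: "r_comp [Dot k] = ht_sym k"
proof -
  have maximal: "{\<beta>. dless [Dot k] \<beta>} = {}"
    using dless_length[of "[Dot k]"] dle_nonempty[of "[Dot k]"] by (auto simp: dless_def)
  show ?thesis
    unfolding r_comp_def R_comp.simps[of "[Dot k]"] maximal
    by (simp add: H_comp_def pi_map_H_gen)
qed

text \<open>
  Absorbing \<open>m\<close> into \<open>(1, \<dots>)\<close> gives the composition starting with \<open>m + 1\<close>, which is also
  the first summand in the product rule for \<open>m + 1\<close>. As the signs alternate, consecutive terms
  cancel.
\<close>

lemma r_hook_telescope:
  "j < N \<Longrightarrow> (\<Sum>m=1..Suc j. h_sym m * ((- 1) ^ (N - m) * r_comp (hook (N - m))))
    = (- 1) ^ (N - Suc j) * r_comp (absorb (pnat_of (Suc j)) (hook (N - Suc j)))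
      - (- 1) ^ N * r_comp (hook N)"
proof (induction j)
  case 0
  have "h_sym 1 * r_comp (hook (N - 1)) = r_comp (hook N) + r_comp (absorb 1 (hook (N - 1)))"
    using h_times_r[of "hook (N - 1)" 1] 0 by (cases N) (auto simp: one_pnat.rep_eq)
  moreover have "(- 1 :: sSym) ^ N = - ((- 1) ^ (N - 1))"
    using 0 by (cases N) auto
  ultimately show ?case by (simp add: one_pnat_def sign_central distrib_left)
next
  case (Suc j)
  define m where "m = pnat_of (Suc (Suc j))"
  have m: "nat_of m = Suc (Suc j)" by (simp add: m_def pnat_of_inverse)
  \<comment> \<open>Absorbing \<open>m - 1\<close> into the leading \<open>1\<close> of the hook produces the entry \<open>m\<close>.\<close>
  have m1: "pnat_of (Suc j) + 1 = m"
    by (simp add: nat_of_inject[symmetric] plus_pnat.rep_eq one_pnat.rep_eq m pnat_of_inverse)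
  have "hook (N - Suc j) = Plain 1 # hook (N - Suc (Suc j))"
    using Suc.prems by (simp add: Suc_diff_Suc flip: replicate_Suc)
  then have "absorb (pnat_of (Suc j)) (hook (N - Suc j)) = Plain m # hook (N - Suc (Suc j))"
    by (simp add: m1)
  moreover have "h_sym (Suc (Suc j)) * r_comp (hook (N - Suc (Suc j)))
      = r_comp (Plain m # hook (N - Suc (Suc j))) + r_comp (absorb m (hook (N - Suc (Suc j))))"
    using h_times_r[of "hook (N - Suc (Suc j))" m] m by simp
  moreover have "(- 1 :: sSym) ^ (N - Suc j) = - ((- 1) ^ (N - Suc (Suc j)))"
  proof -
    have "N - Suc j = Suc (N - Suc (Suc j))" using Suc.prems by arith
    then show ?thesis by simp
  qed
  ultimately show ?case
    using Suc by (simp add: m_def[symmetric] sign_central distrib_left)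
qed

lemma r_hook_recursion:
  assumes "0 < N"
  shows "(- 1) ^ N * r_comp (hook N)
      + (\<Sum>m=1..N. h_sym m * ((- 1) ^ (N - m) * r_comp (hook (N - m)))) = ht_sym N"
proof -
  obtain j where N: "N = Suc j" using assms by (cases N) auto
  have "absorb (pnat_of N) (hook 0) = [Dot N]"
    by (simp add: N pnat_of_inverse)
  then show ?thesis
    using r_hook_telescope[of j N] by (simp add: N r_Dot)
qed

section \<open>Coefficients of symmetric functions in superspace\<close>

abbreviation scoeff :: "sSym \<Rightarrow> smon \<Rightarrow> rat" where
  "scoeff f M \<equiv> Defs.coeff (Rep_sSym f) M"

lemma scoeff_add: "scoeff (f + g) M = scoeff f M + scoeff g M"
  by (simp add: plus_sSym.rep_eq plus_sps.rep_eq)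

lemma scoeff_zero: "scoeff 0 M = 0"
  by (simp add: zero_sSym.rep_eq zero_sps.rep_eq)

lemma scoeff_one: "scoeff 1 M = (if M = ({}, 0) then 1 else 0)"
  by (simp add: one_sSym.rep_eq one_sps.rep_eq)

lemma scoeff_uminus: "scoeff (- f) M = - scoeff f M"
  by (simp add: uminus_sSym.rep_eq uminus_sps.rep_eq)

lemma scoeff_sum: "scoeff (\<Sum>i\<in>I. f i) M = (\<Sum>i\<in>I. scoeff (f i) M)"
  by (induction I rule: infinite_finite_induct) (simp_all add: scoeff_add scoeff_zero)

lemma scoeff_of_nat_times: "scoeff (of_nat c * f) M = of_nat c * scoeff f M"
  by (induction c) (simp_all add: scoeff_add scoeff_zero algebra_simps)

lemma scoeff_sign_times: "scoeff ((- 1) ^ n * f) M = (- 1) ^ n * scoeff f M"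
  by (cases "even n") (simp_all add: scoeff_uminus)

lemma sSym_eqI: "(\<And>S a. finite S \<Longrightarrow> scoeff f (S, a) = scoeff g (S, a)) \<Longrightarrow> f = g"
  unfolding Rep_sSym_inject[symmetric] by (rule sps_eqI) (metis prod.collapse)

text \<open>
  Without \<open>\<theta>\<close>'s in the left factor no reordering sign appears, and the right factor carries all
  of \<open>S\<close>.
\<close>

lemma scoeff_times_theta_free:
  assumes free: "\<And>S a. S \<noteq> {} \<Longrightarrow> scoeff f (S, a) = 0" and S: "finite S"
  shows "scoeff (f * g) (S, a) = (\<Sum>(b, c)\<in>{(b, c). b + c = a}. scoeff f ({}, b) * scoeff g (S, c))"
proof -
  let ?D = "{(b, c). b + c = a}" and ?i = "\<lambda>(b, c). (({} :: nat set, b), (S, c))"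
  have "scoeff (f * g) (S, a) = (\<Sum>z\<in>decs (S, a).
      ksgn (fst (fst z)) (fst (snd z)) * scoeff f (fst z) * scoeff g (snd z))"
    by (simp add: times_sSym.rep_eq coeff_times')
  also have "\<dots> = (\<Sum>z\<in>?i ` ?D. ksgn (fst (fst z)) (fst (snd z)) * scoeff f (fst z) * scoeff g (snd z))"
  proof (rule sum.mono_neutral_right)
    show "\<forall>z\<in>decs (S, a) - ?i ` ?D.
        ksgn (fst (fst z)) (fst (snd z)) * scoeff f (fst z) * scoeff g (snd z) = 0"
    proof
      fix z assume z: "z \<in> decs (S, a) - ?i ` ?D"
      obtain T b U c where zz: "z = ((T, b), (U, c))" by (metis surj_pair)
      have "T \<noteq> {}"
        using z by (force simp: zz decs_def)
      then show "ksgn (fst (fst z)) (fst (snd z)) * scoeff f (fst z) * scoeff g (snd z) = 0"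
        by (simp add: zz free)
    qed
    show "finite (decs (S, a))" using S by simp
  qed (auto simp: decs_def)
  also have "\<dots> = (\<Sum>(b, c)\<in>?D. scoeff f ({}, b) * scoeff g (S, c))"
    by (subst sum.reindex) (auto simp: inj_on_def intro!: sum.cong)
  finally show ?thesis .
qed

definition xdeg :: "(nat \<Rightarrow>\<^sub>0 nat) \<Rightarrow> nat" where
  "xdeg a = (\<Sum>i\<in>Poly_Mapping.keys a. Poly_Mapping.lookup a i)"

lemma xdeg_add: "xdeg (a + b) = xdeg a + xdeg b"
  unfolding xdeg_def by (rule setsum_keys_plus_distrib) auto

lemma xdeg_single [simp]: "xdeg (Poly_Mapping.single i k) = k"
  by (simp add: xdeg_def)

definition exponent_vec :: "nat list \<Rightarrow> nat list \<Rightarrow> (nat \<Rightarrow>\<^sub>0 nat)" where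
  "exponent_vec ix ks = sum_list (map2 Poly_Mapping.single ix ks)"

definition nonzero_exponents :: "(nat \<Rightarrow>\<^sub>0 nat) \<Rightarrow> nat multiset" where
  "nonzero_exponents a = image_mset (Poly_Mapping.lookup a) (mset_set (Poly_Mapping.keys a))"

lemma sum_mset_nonzero_exponents: "sum_mset (nonzero_exponents a) = xdeg a"
  by (simp add: nonzero_exponents_def xdeg_def sum_unfold_sum_mset)

lemma nonzero_exponents_pos: "k \<in># nonzero_exponents a \<Longrightarrow> 1 \<le> k"
  by (auto simp: nonzero_exponents_def in_keys_iff)

text \<open>
  Positivity of the exponents makes the indices recoverable from the monomial: a zero exponent
  would leave its variable invisible.
\<close>

lemma keys_lookup_exponent_vec:
  assumes "length ix = length ks" "distinct ix" "\<forall>k\<in>set ks. 1 \<le> k"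
  shows "Poly_Mapping.keys (exponent_vec ix ks) = set ix \<and> map (Poly_Mapping.lookup (exponent_vec ix ks)) ix = ks"
  using assms
proof (induction ix ks rule: list_induct2)
  case Nil
  then show ?case by (simp add: exponent_vec_def)
next
  case (Cons i ix k ks)
  have e: "exponent_vec (i # ix) (k # ks) = Poly_Mapping.single i k + exponent_vec ix ks" by (simp add: exponent_vec_def)
  have IH: "Poly_Mapping.keys (exponent_vec ix ks) = set ix" "map (Poly_Mapping.lookup (exponent_vec ix ks)) ix = ks"
    using Cons by auto
  have "Poly_Mapping.keys (exponent_vec (i # ix) (k # ks)) = set (i # ix)"
    using IH(1) Cons.prems unfolding e
    by (auto simp: in_keys_iff lookup_add lookup_single when_def set_eq_iff split: if_splits)
  moreover have "map (Poly_Mapping.lookup (exponent_vec (i # ix) (k # ks))) ix = map (Poly_Mapping.lookup (exponent_vec ix ks)) ix"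
    using Cons.prems unfolding e by (auto simp: lookup_add lookup_single when_def)
  moreover
  have "Poly_Mapping.lookup (exponent_vec ix ks) i = 0"
    using IH(1) Cons.prems by (simp flip: not_in_keys_iff_lookup_eq_zero)
  then have "Poly_Mapping.lookup (exponent_vec (i # ix) (k # ks)) i = k" by (simp add: e lookup_add)
  ultimately show ?case using IH(2) by simp
qed

lemma exponent_vec_lookup:
  assumes "distinct ix" "set ix = Poly_Mapping.keys a"
  shows "exponent_vec ix (map (Poly_Mapping.lookup a) ix) = a"
proof -
  have "map2 Poly_Mapping.single ix (map (Poly_Mapping.lookup a) ix)
      = map (\<lambda>i. Poly_Mapping.single i (Poly_Mapping.lookup a i)) ix"
    by (induction ix) auto
  then have "exponent_vec ix (map (Poly_Mapping.lookup a) ix)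
      = (\<Sum>i\<in>Poly_Mapping.keys a. Poly_Mapping.single i (Poly_Mapping.lookup a i))"
    unfolding exponent_vec_def by (simp only: sum_list_distinct_conv_sum_set[OF assms(1)] assms(2))
  also have "\<dots> = a" by (rule poly_mapping_sum_single[symmetric])
  finally show ?thesis .
qed

lemma image_mset_eq_msetE:
  assumes "image_mset f X = mset ks"
  obtains ix where "mset ix = X" "map f ix = ks"
proof -
  have "\<exists>ix. mset ix = X \<and> map f ix = ks"
    using assms
  proof (induction ks arbitrary: X)
    case Nil
    then show ?case by simp
  next
    case (Cons k ks)
    obtain Y i where iY: "X = add_mset i Y" "f i = k" "image_mset f Y = mset ks"
      using msed_map_invR[of f X k "mset ks"] Cons.prems by auto
    obtain ix where "mset ix = Y" "map f ix = ks" using Cons.IH[OF iY(3)] by blast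
    with iY(1,2) have "mset (i # ix) = X" "map f (i # ix) = k # ks" by simp_all
    then show ?case by (intro exI[of _ "i # ix"] conjI)
  qed
  then show thesis using that by blast
qed

text \<open>
  A monomial occurs in a monomial symmetric function iff its nonzero exponents, in any order, are the
  parts. This makes the indexing by index lists disappear from the coefficients.
\<close>

lemma ex_exponent_vec_iff:
  assumes pos: "\<forall>k\<in>set ks. 1 \<le> k"
  shows "(\<exists>ix. length ix = length ks \<and> distinct ix \<and> exponent_vec ix ks = a) \<longleftrightarrow> mset ks = nonzero_exponents a"
proof
  assume "\<exists>ix. length ix = length ks \<and> distinct ix \<and> exponent_vec ix ks = a"
  then obtain ix where ix: "length ix = length ks" "distinct ix" and a: "exponent_vec ix ks = a" by blast
  have "mset ks = image_mset (Poly_Mapping.lookup a) (mset ix)"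
    using keys_lookup_exponent_vec[OF ix pos] by (metis a mset_map)
  also have "mset ix = mset_set (Poly_Mapping.keys a)"
    using keys_lookup_exponent_vec[OF ix pos] ix(2) by (simp add: a mset_set_set)
  finally show "mset ks = nonzero_exponents a" by (simp add: nonzero_exponents_def)
next
  assume "mset ks = nonzero_exponents a"
  then have "image_mset (Poly_Mapping.lookup a) (mset_set (Poly_Mapping.keys a)) = mset ks"
    by (simp add: nonzero_exponents_def)
  then obtain ix where ix: "mset ix = mset_set (Poly_Mapping.keys a)" "map (Poly_Mapping.lookup a) ix = ks"
    by (rule image_mset_eq_msetE)
  have set: "set ix = Poly_Mapping.keys a"
    using arg_cong[OF ix(1), of set_mset] by simp
  moreover have "distinct ix"
    using arg_cong[OF ix(1), of size] by (simp add: card_distinct set)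
  moreover have "length ix = length ks"
    using ix(2) by (metis length_map)
  ultimately show "\<exists>ix. length ix = length ks \<and> distinct ix \<and> exponent_vec ix ks = a"
    using exponent_vec_lookup[of ix a] ix(2) by (intro exI[of _ ix]) auto
qed

text \<open>
  Distinct terms with coefficient \<open>1\<close> are distinct monomials, so each monomial is met at most
  once.
\<close>

lemma coeff_lfsum_monoms:
  assumes "\<And>t. t \<in> A \<Longrightarrow> \<exists>N. Defs.monom 1 N t"
  shows "Defs.coeff (lfsum A (\<lambda>t. t)) M = (if \<exists>t\<in>A. Defs.monom 1 M t then 1 else 0)"
proof -
  have eq: "{t \<in> A. Defs.coeff t M \<noteq> 0} = {t \<in> A. Defs.monom 1 M t}"
    using assms by (auto simp: monomD split: if_splits) (metis (full_types) monomD)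
  show ?thesis
  proof (cases "\<exists>t\<in>A. Defs.monom 1 M t")
    case True
    then obtain t where t: "t \<in> A" "Defs.monom 1 M t" by blast
    then have "{t \<in> A. Defs.monom 1 M t} = {t}" using monom_eqI by blast
    with t show ?thesis unfolding lfsum.rep_eq eq by (auto simp: monomD)
  next
    case False
    then have none: "{t \<in> A. Defs.monom 1 M t} = {}" by blast
    show ?thesis unfolding lfsum.rep_eq eq none using False by simp
  qed
qed

lemma monom_unique: "Defs.monom 1 M t \<Longrightarrow> Defs.monom 1 N t \<longleftrightarrow> N = M"
  using monomD[of 1 M t M] monomD[of 1 N t M] by (auto split: if_splits)

lemma monom_xprod:
  "Defs.monom 1 ({}, exponent_vec ix ks) (prod_list (map2 (\<lambda>i k. xvar i ^ k) ix ks))"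
proof (induction ix ks rule: list_induct2')
  case (4 i ix k ks)
  then show ?case
    using monom_times[OF monom_xvar_power 4, of i k] by (simp add: exponent_vec_def)
qed (simp_all add: exponent_vec_def monom_one)

lemma monom_mterm_even: "Defs.monom 1 ({}, exponent_vec ix ks) (mterm ([], ks) ix)"
  using monom_xprod by (simp add: mterm_def df_def)

lemma monom_mterm_odd:
  "Defs.monom 1 ({i}, Poly_Mapping.single i k + exponent_vec ix ks) (mterm ([k], ks) (i # ix))"
  using monom_times[OF monom_theta monom_xprod[of "i # ix" "k # ks"], of i]
  by (simp add: mterm_def df_def exponent_vec_def)

lemma scoeff_mono_fun_even:
  assumes pos: "\<forall>k\<in>set ks. 1 \<le> k"
  shows "scoeff (mono_fun ([], ks)) (S, a) = (if S = {} \<and> mset ks = nonzero_exponents a then 1 else 0)"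
proof -
  have "scoeff (mono_fun ([], ks)) (S, a) = (if \<exists>t\<in>mterms ([], ks). Defs.monom 1 (S, a) t then 1 else 0)"
    unfolding mono_fun.rep_eq
    by (rule coeff_lfsum_monoms) (auto simp: mterms_def intro: monom_mterm_even)
  also have "(\<exists>t\<in>mterms ([], ks). Defs.monom 1 (S, a) t) \<longleftrightarrow>
      S = {} \<and> (\<exists>ix. length ix = length ks \<and> distinct ix \<and> exponent_vec ix ks = a)"
    by (auto simp: mterms_def monom_unique[OF monom_mterm_even] Bex_def)
  finally show ?thesis unfolding ex_exponent_vec_iff[OF pos] .
qed

definition drop_var :: "nat \<Rightarrow> (nat \<Rightarrow>\<^sub>0 nat) \<Rightarrow> (nat \<Rightarrow>\<^sub>0 nat)" where
  "drop_var i a = a - Poly_Mapping.single i (Poly_Mapping.lookup a i)"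

lemma single_plus_drop_var: "Poly_Mapping.single i (Poly_Mapping.lookup a i) + drop_var i a = a"
  by (rule poly_mapping_eqI) (auto simp: drop_var_def lookup_add lookup_minus lookup_single when_def)

lemma drop_var_eq_iff:
  "i \<notin> Poly_Mapping.keys b \<Longrightarrow> a = Poly_Mapping.single i k + b \<longleftrightarrow> Poly_Mapping.lookup a i = k \<and> b = drop_var i a"
  by (metis (no_types, lifting) add_diff_cancel_left' drop_var_def lookup_add lookup_single_eq
      not_in_keys_iff_lookup_eq_zero add.right_neutral single_plus_drop_var)

lemma not_in_keys_drop_var: "i \<notin> Poly_Mapping.keys (drop_var i a)"
  by (simp add: in_keys_iff drop_var_def lookup_minus)

lemma xdeg_drop_var: "xdeg a = Poly_Mapping.lookup a i + xdeg (drop_var i a)"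
  by (metis single_plus_drop_var xdeg_add xdeg_single)

text \<open>
  With a single \<open>\<theta>\<^sub>i\<close>, the exponent of \<open>x\<^sub>i\<close> must be the fermionic part \<open>k\<close>, which may be \<open>0\<close>;
  the other exponents are treated as in the case without \<open>\<theta>\<close>.
\<close>

lemma scoeff_mono_fun_odd:
  assumes pos: "\<forall>k\<in>set ks. 1 \<le> k"
  shows "scoeff (mono_fun ([k], ks)) (S, a) =
    (if \<exists>i. S = {i} \<and> Poly_Mapping.lookup a i = k \<and> mset ks = nonzero_exponents (drop_var i a) then 1 else 0)"
proof -
  have ix: "i \<notin> set ix \<and> a = Poly_Mapping.single i k + exponent_vec ix ks
      \<longleftrightarrow> Poly_Mapping.lookup a i = k \<and> exponent_vec ix ks = drop_var i a"
    if "length ix = length ks" "distinct ix" for i ix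
    using keys_lookup_exponent_vec[OF that pos] drop_var_eq_iff[of i "exponent_vec ix ks" a k] not_in_keys_drop_var[of i a]
      single_plus_drop_var[of i a] by auto
  have "scoeff (mono_fun ([k], ks)) (S, a) = (if \<exists>t\<in>mterms ([k], ks). Defs.monom 1 (S, a) t then 1 else 0)"
    unfolding mono_fun.rep_eq
    by (rule coeff_lfsum_monoms) (auto simp: mterms_def length_Suc_conv intro: monom_mterm_odd)
  also have "(\<exists>t\<in>mterms ([k], ks). Defs.monom 1 (S, a) t) \<longleftrightarrow>
      (\<exists>i ix. length ix = length ks \<and> distinct (i # ix) \<and> Defs.monom 1 (S, a) (mterm ([k], ks) (i # ix)))"
    by (force simp: mterms_def length_Suc_conv)
  also have "\<dots> \<longleftrightarrow> (\<exists>i. S = {i} \<and> (\<exists>ix. length ix = length ks \<and> distinct ix \<and>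
      i \<notin> set ix \<and> a = Poly_Mapping.single i k + exponent_vec ix ks))"
    unfolding monom_unique[OF monom_mterm_odd] by auto
  also have "\<dots> \<longleftrightarrow> (\<exists>i. S = {i} \<and> (\<exists>ix. length ix = length ks \<and> distinct ix \<and>
      Poly_Mapping.lookup a i = k \<and> exponent_vec ix ks = drop_var i a))"
    using ix by blast
  also have "\<dots> \<longleftrightarrow> (\<exists>i. S = {i} \<and> Poly_Mapping.lookup a i = k \<and> mset ks = nonzero_exponents (drop_var i a))"
    unfolding ex_exponent_vec_iff[OF pos, symmetric] by blast
  finally show ?thesis .
qed

section \<open>The coefficients of the four families\<close>

definition partitions :: "nat \<Rightarrow> nat list set" where
  "partitions r = {ks. sorted_wrt (\<ge>) ks \<and> (\<forall>k\<in>set ks. 1 \<le> k) \<and> sum_list ks = r}"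

lemma superpartitions_even:
  "{\<Lambda>. superpartition \<Lambda> \<and> psize \<Lambda> = r \<and> df \<Lambda> = 0} = Pair [] ` partitions r"
  by (auto simp: superpartition_def psize_def df_def partitions_def)

lemma finite_partitions: "finite (partitions r)"
  using finite_superpartitions[of r 0] unfolding superpartitions_even
  by (rule finite_imageD) (simp add: inj_on_def)

lemma superpartitions_odd:
  "{\<Lambda>. superpartition \<Lambda> \<and> psize \<Lambda> = r \<and> df \<Lambda> = 1}
     = (\<lambda>(k, ks). ([k], ks)) ` (SIGMA k:{..r}. partitions (r - k))"
proof (intro equalityI subsetI)
  fix \<Lambda> assume "\<Lambda> \<in> {\<Lambda>. superpartition \<Lambda> \<and> psize \<Lambda> = r \<and> df \<Lambda> = 1}"
  moreover obtain as bs where "\<Lambda> = (as, bs)" by (cases \<Lambda>)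
  ultimately obtain k where "\<Lambda> = ([k], bs)" "superpartition ([k], bs)" "k + sum_list bs = r"
    by (auto simp: psize_def df_def length_Suc_conv)
  then show "\<Lambda> \<in> (\<lambda>(k, ks). ([k], ks)) ` (SIGMA k:{..r}. partitions (r - k))"
    by (intro image_eqI[of _ _ "(k, bs)"]) (auto simp: superpartition_def partitions_def)
qed (auto simp: superpartition_def psize_def df_def partitions_def)

lemma mset_eq_iff_sorted:
  assumes "sorted_wrt (\<ge>) (ks :: nat list)"
  shows "mset ks = X \<longleftrightarrow> ks = rev (sorted_list_of_multiset X)"
proof
  assume "mset ks = X"
  moreover have "sorted (rev ks)" using assms by (simp add: sorted_wrt_rev)
  ultimately have "sorted_list_of_multiset X = rev ks"
    by (metis mset_rev sorted_list_of_multiset_mset sorted_sort_id)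
  then show "ks = rev (sorted_list_of_multiset X)" by simp
qed simp

text \<open>
  Exactly one partition has a given multiset of parts.
\<close>

lemma sum_partitions_indicator:
  "(\<Sum>ks\<in>partitions r. if mset ks = nonzero_exponents a then 1 else 0 :: rat) = (if xdeg a = r then 1 else 0)"
proof -
  let ?ks = "rev (sorted_list_of_multiset (nonzero_exponents a))"
  have iff: "mset ks = nonzero_exponents a \<longleftrightarrow> ks = ?ks" if "ks \<in> partitions r" for ks
    using that mset_eq_iff_sorted by (auto simp: partitions_def)
  have "sum_list ?ks = xdeg a"
    unfolding sum_mset_nonzero_exponents[symmetric] by (metis mset_rev mset_sorted_list_of_multiset sum_mset_sum_list)
  then have mem: "?ks \<in> partitions r \<longleftrightarrow> xdeg a = r"
    using nonzero_exponents_pos[of _ a] by (auto simp: partitions_def sorted_wrt_rev)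
  have "(\<Sum>ks\<in>partitions r. if mset ks = nonzero_exponents a then 1 else 0 :: rat) = (\<Sum>ks\<in>partitions r. if ks = ?ks then 1 else 0)"
    by (intro sum.cong refl) (simp add: iff)
  then show ?thesis using finite_partitions mem by simp
qed

lemma scoeff_h: "scoeff (h_sym r) (S, a) = (if S = {} \<and> xdeg a = r then 1 else 0)"
proof -
  have "scoeff (h_sym r) (S, a) = (\<Sum>ks\<in>partitions r. scoeff (mono_fun ([], ks)) (S, a))"
    unfolding h_sym_def superpartitions_even by (simp add: scoeff_sum sum.reindex inj_on_def)
  also have "\<dots> = (\<Sum>ks\<in>partitions r. if S = {} \<and> mset ks = nonzero_exponents a then 1 else 0)"
    by (intro sum.cong refl scoeff_mono_fun_even) (simp add: partitions_def)
  also have "\<dots> = (if S = {} \<and> xdeg a = r then 1 else 0)"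
    using sum_partitions_indicator[of a r] by (cases "S = {}") auto
  finally show ?thesis .
qed

lemma scoeff_ht:
  "scoeff (ht_sym r) (S, a) =
    (if \<exists>i. S = {i} then of_nat (Poly_Mapping.lookup a (the_elem S) + 1) * (if xdeg a = r then 1 else 0) else 0)"
proof -
  have "scoeff (ht_sym r) (S, a)
      = (\<Sum>(k, ks)\<in>(SIGMA k:{..r}. partitions (r - k)). of_nat (k + 1) * scoeff (mono_fun ([k], ks)) (S, a))"
    unfolding ht_sym_def superpartitions_odd
    by (subst sum.reindex) (auto simp: scoeff_sum scoeff_of_nat_times inj_on_def case_prod_unfold
        simp del: of_nat_Suc of_nat_add intro!: sum.cong)
  also have "\<dots> = (\<Sum>k\<le>r. \<Sum>ks\<in>partitions (r - k). of_nat (k + 1) *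
      (if \<exists>i. S = {i} \<and> Poly_Mapping.lookup a i = k \<and> mset ks = nonzero_exponents (drop_var i a) then 1 else 0))"
  proof (subst sum.Sigma[symmetric])
    fix k
    show "(\<Sum>k\<le>r. \<Sum>ks\<in>partitions (r - k). of_nat (k + 1) * scoeff (mono_fun ([k], ks)) (S, a))
      = (\<Sum>k\<le>r. \<Sum>ks\<in>partitions (r - k). of_nat (k + 1) *
      (if \<exists>i. S = {i} \<and> Poly_Mapping.lookup a i = k \<and> mset ks = nonzero_exponents (drop_var i a) then 1 else 0))"
      by (intro sum.cong refl arg_cong2[of _ _ _ _ "(*)"] scoeff_mono_fun_odd) (simp add: partitions_def)
  qed (simp_all add: finite_partitions)
  also have "\<dots> = (if \<exists>i. S = {i} then of_nat (Poly_Mapping.lookup a (the_elem S) + 1) * (if xdeg a = r then 1 else 0) else 0)"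
  proof (cases "\<exists>i. S = {i}")
    case True
    then obtain i where S: "S = {i}" by blast
    let ?l = "Poly_Mapping.lookup a i"
    have "(\<Sum>k\<le>r. \<Sum>ks\<in>partitions (r - k). of_nat (k + 1) *
        (if \<exists>i. S = {i} \<and> Poly_Mapping.lookup a i = k \<and> mset ks = nonzero_exponents (drop_var i a) then 1 else 0 :: rat))
      = (\<Sum>k\<le>r. if k = ?l then of_nat (k + 1) * (if xdeg (drop_var i a) = r - k then 1 else 0) else 0)"
    proof (intro sum.cong refl)
      fix k
      show "(\<Sum>ks\<in>partitions (r - k). of_nat (k + 1) *
          (if \<exists>i. S = {i} \<and> Poly_Mapping.lookup a i = k \<and> mset ks = nonzero_exponents (drop_var i a) then 1 else 0 :: rat))
        = (if k = ?l then of_nat (k + 1) * (if xdeg (drop_var i a) = r - k then 1 else 0) else 0)"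
        unfolding sum_distrib_left[symmetric] sum_partitions_indicator[symmetric] by (auto simp: S)
    qed
    also have "\<dots> = (if ?l \<le> r then of_nat (?l + 1) * (if xdeg (drop_var i a) = r - ?l then 1 else 0) else 0)"
      by simp
    also have "\<dots> = of_nat (?l + 1) * (if xdeg a = r then 1 else 0)"
      using xdeg_drop_var[of a i] by auto
    finally show ?thesis by (simp add: S)
  qed auto
  finally show ?thesis .
qed

definition sqfree :: "(nat \<Rightarrow>\<^sub>0 nat) \<Rightarrow> bool" where
  "sqfree a \<longleftrightarrow> (\<forall>i\<in>Poly_Mapping.keys a. Poly_Mapping.lookup a i = 1)"

lemma xdeg_sqfree: "sqfree a \<Longrightarrow> xdeg a = card (Poly_Mapping.keys a)"
  by (simp add: xdeg_def sqfree_def)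

lemma scoeff_e: "scoeff (e_sym r) (S, a) = (if S = {} \<and> sqfree a \<and> xdeg a = r then 1 else 0)"
proof (cases "r = 0")
  case True
  have "a = 0 \<longleftrightarrow> sqfree a \<and> xdeg a = 0"
    by (metis xdeg_sqfree card_eq_0_iff finite_keys keys_eq_empty sqfree_def empty_iff)
  then show ?thesis using True by (auto simp: e_sym_def scoeff_one)
next
  case False
  have "replicate_mset r 1 = nonzero_exponents a \<longleftrightarrow> sqfree a \<and> xdeg a = r"
  proof
    assume *: "replicate_mset r 1 = nonzero_exponents a"
    have "set_mset (nonzero_exponents a) \<subseteq> {1}" unfolding *[symmetric] by (simp split: if_splits)
    then have "sqfree a" by (auto simp: sqfree_def nonzero_exponents_def)
    moreover have "xdeg a = r" unfolding sum_mset_nonzero_exponents[symmetric] *[symmetric] by simp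
    ultimately show "sqfree a \<and> xdeg a = r" ..
  next
    assume *: "sqfree a \<and> xdeg a = r"
    then have "nonzero_exponents a = image_mset (\<lambda>_. 1) (mset_set (Poly_Mapping.keys a))"
      unfolding nonzero_exponents_def by (intro image_mset_cong) (simp add: sqfree_def)
    with * show "replicate_mset r 1 = nonzero_exponents a"
      using xdeg_sqfree[of a] by (simp add: image_mset_const_eq)
  qed
  then show ?thesis
    using False scoeff_mono_fun_even[of "replicate r 1" S a] by (simp add: e_sym_def)
qed

lemma scoeff_pt:
  "scoeff (pt_sym k) (S, a) = (if \<exists>i. S = {i} \<and> a = Poly_Mapping.single i k then 1 else 0)"
proof -
  have m: "Defs.monom 1 ({i}, Poly_Mapping.single i k) (theta i * xvar i ^ k)" for i
    using monom_times[OF monom_theta monom_xvar_power, of i i k] by simp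
  have c: "Defs.coeff (theta i * xvar i ^ k) (S, a) = (if S = {i} \<and> a = Poly_Mapping.single i k then 1 else 0)" for i
    using monomD[OF m, of i "(S, a)"] by simp
  show ?thesis
  proof (cases "\<exists>i. S = {i} \<and> a = Poly_Mapping.single i k")
    case True
    then obtain i where i: "S = {i}" "a = Poly_Mapping.single i k" by blast
    then have one: "{j \<in> UNIV. Defs.coeff (theta j * xvar j ^ k) (S, a) \<noteq> 0} = {i}"
      unfolding c by auto
    show ?thesis unfolding pt_sym.rep_eq lfsum.rep_eq one unfolding c using i by auto
  next
    case False
    then have none: "{j \<in> UNIV. Defs.coeff (theta j * xvar j ^ k) (S, a) \<noteq> 0} = {}"
      unfolding c by auto
    show ?thesis unfolding pt_sym.rep_eq lfsum.rep_eq none using False by simp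
  qed
qed

section \<open>Two product identities\<close>

text \<open>
  Extracts from a convolution of degree \<open>N\<close> the only summand whose two factors have the degrees
  \<open>p\<close> and \<open>q\<close>.
\<close>

lemma sum_delta_diff:
  fixes p q N :: nat
  shows "(\<Sum>m=0..N. if p = m \<and> q = N - m then f m else 0 :: rat) = (if p + q = N then f p else 0)"
proof -
  have "(\<Sum>m=0..N. if p = m \<and> q = N - m then f m else 0) = (\<Sum>m=0..N. if m = p then (if p + q = N then f p else 0) else 0)"
  proof (intro sum.cong refl)
    fix m assume "m \<in> {0..N}"
    then have "q = N - m \<longleftrightarrow> m + q = N" by auto
    then show "(if p = m \<and> q = N - m then f m else 0) = (if m = p then (if p + q = N then f p else 0) else 0)"
      by auto
  qed
  then show ?thesis by auto
qed

text \<open>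
  A term of the product contributing to \<open>\<theta>\<^sub>i x\<^sup>a\<close> is determined by the exponent \<open>l \<le> a\<^sub>i\<close> of the
  factor \<open>\<theta>\<^sub>i x\<^sub>i\<^sup>l\<close> taken from the power sum.
\<close>

lemma h_times_pt: "(\<Sum>m=0..N. h_sym m * pt_sym (N - m)) = ht_sym N"
proof (rule sSym_eqI)
  fix S :: "nat set" and a :: "nat \<Rightarrow>\<^sub>0 nat" assume S: "finite S"
  let ?D = "{(b, c). b + c = a}"
  have "scoeff (\<Sum>m=0..N. h_sym m * pt_sym (N - m)) (S, a)
      = (\<Sum>m=0..N. \<Sum>(b, c)\<in>?D. scoeff (h_sym m) ({}, b) * scoeff (pt_sym (N - m)) (S, c))"
    unfolding scoeff_sum by (intro sum.cong refl scoeff_times_theta_free S) (simp add: scoeff_h)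
  also have "\<dots> = scoeff (ht_sym N) (S, a)"
  proof (cases "\<exists>i. S = {i}")
    case False
    then show ?thesis by (auto simp: scoeff_pt scoeff_ht intro!: sum.neutral)
  next
    case True
    then obtain i where i: "S = {i}" by blast
    \<comment> \<open>The pairs \<open>(b, c)\<close> that contribute for some \<open>m\<close>, necessarily for \<open>m = xdeg b\<close> only.\<close>
    let ?P = "\<lambda>(b, c). c = Poly_Mapping.single i (xdeg c) \<and> xdeg a = N"
    let ?l = "Poly_Mapping.lookup a i"
    have "(\<Sum>m=0..N. \<Sum>(b, c)\<in>?D. scoeff (h_sym m) ({}, b) * scoeff (pt_sym (N - m)) (S, c))
        = (\<Sum>z\<in>?D. \<Sum>m=0..N. scoeff (h_sym m) ({}, fst z) * scoeff (pt_sym (N - m)) (S, snd z))"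
      unfolding case_prod_unfold by (rule sum.swap)
    also have "\<dots> = (\<Sum>z\<in>?D. if ?P z then 1 else 0)"
    proof (rule sum.cong[OF refl])
      fix z assume "z \<in> ?D"
      then obtain b c where z: "z = (b, c)" and a: "b + c = a" by auto
      have "(\<Sum>m=0..N. scoeff (h_sym m) ({}, b) * scoeff (pt_sym (N - m)) (S, c))
          = (\<Sum>m=0..N. if xdeg b = m \<and> xdeg c = N - m then if c = Poly_Mapping.single i (xdeg c) then 1 else 0 else 0)"
        unfolding scoeff_h scoeff_pt i by (intro sum.cong refl) auto
      also have "\<dots> = (if ?P z then 1 else 0)"
        unfolding sum_delta_diff by (auto simp: z xdeg_add simp flip: a)
      finally show "(\<Sum>m=0..N. scoeff (h_sym m) ({}, fst z) * scoeff (pt_sym (N - m)) (S, snd z))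
          = (if ?P z then 1 else 0)" by (simp add: z)
    qed
    also have "\<dots> = of_nat (card {z \<in> ?D. ?P z})"
      using finite_add_decomps[of a] by (simp flip: sum.inter_filter)
    also have "{z \<in> ?D. ?P z} =
        (if xdeg a = N then (\<lambda>l. (a - Poly_Mapping.single i l, Poly_Mapping.single i l)) ` {..?l} else {})"
    proof -
      have split: "b = a - c \<and> xdeg c \<le> ?l" if "b + c = a" "c = Poly_Mapping.single i (xdeg c)" for b c
      proof
        show "b = a - c" using that(1) by auto
        have "Poly_Mapping.lookup c i = xdeg c" by (subst that(2)) simp
        then show "xdeg c \<le> ?l" by (simp add: lookup_add flip: that(1))
      qed
      have merge: "a - Poly_Mapping.single i l + Poly_Mapping.single i l = a" if "l \<le> ?l" for l
        by (rule poly_mapping_eqI) (use that in \<open>auto simp: lookup_add lookup_minus lookup_single when_def\<close>)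
      have "{z \<in> ?D. case z of (b, c) \<Rightarrow> c = Poly_Mapping.single i (xdeg c)}
          = (\<lambda>l. (a - Poly_Mapping.single i l, Poly_Mapping.single i l)) ` {..?l}"
      proof (intro equalityI subsetI)
        fix z assume "z \<in> {z \<in> ?D. case z of (b, c) \<Rightarrow> c = Poly_Mapping.single i (xdeg c)}"
        then obtain b c where z: "z = (b, c)" and bc: "b + c = a" "c = Poly_Mapping.single i (xdeg c)"
          by auto
        then have "z = (a - Poly_Mapping.single i (xdeg c), Poly_Mapping.single i (xdeg c))"
          using split[OF bc] by (metis (no_types))
        with split[OF bc] show "z \<in> (\<lambda>l. (a - Poly_Mapping.single i l, Poly_Mapping.single i l)) ` {..?l}"
          by blast
      qed (auto simp: merge)
      then show ?thesis by auto
    qed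
    also have "of_nat (card \<dots>) = scoeff (ht_sym N) (S, a)"
    proof -
      have "inj_on (\<lambda>l. (a - Poly_Mapping.single i l, Poly_Mapping.single i l)) {..?l}"
        by (rule inj_onI) (metis Pair_inject xdeg_single)
      then show ?thesis by (simp add: scoeff_ht i card_image)
    qed
    finally show ?thesis .
  qed
  finally show "scoeff (\<Sum>m=0..N. h_sym m * pt_sym (N - m)) (S, a) = scoeff (ht_sym N) (S, a)" .
qed

lemma sum_sign_subsets: "finite A \<Longrightarrow> (\<Sum>T\<in>Pow A. (- 1 :: rat) ^ card T) = (if A = {} then 1 else 0)"
  using prod_diff_conv_sum[of A "\<lambda>_. 1 :: rat" "\<lambda>_. 1"] by (auto simp: power_0_left)

text \<open>
  Squarefree divisors of \<open>x\<^sup>a\<close> correspond to the subsets of its support, so the sum is the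
  alternating sum over all subsets of a finite set.
\<close>

lemma sum_sign_sqfree_divisors:
  "(\<Sum>z\<in>{(b, c). b + c = a}. if sqfree (fst z) then (- 1 :: rat) ^ xdeg (fst z) else 0) = (if a = 0 then 1 else 0)"
proof -
  let ?D = "{(b, c). b + c = a}" and ?K = "Poly_Mapping.keys a"
  define mon where "mon T = (\<Sum>i\<in>T. Poly_Mapping.single i (1 :: nat))" for T :: "nat set"
  have lookup_mon: "Poly_Mapping.lookup (mon T) i = (if i \<in> T then 1 else 0)" if "finite T" for T i
    using that by (simp add: mon_def lookup_sum lookup_single when_def)
  have keys_mon: "Poly_Mapping.keys (mon T) = T" if "finite T" for T
    using lookup_mon[OF that] by (auto simp: in_keys_iff split: if_splits)
  have fin: "finite T" if "T \<in> Pow ?K" for T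
    using that by (auto intro: finite_subset[OF _ finite_keys])
  have "(\<Sum>z\<in>?D. if sqfree (fst z) then (- 1 :: rat) ^ xdeg (fst z) else 0)
      = (\<Sum>z\<in>{z \<in> ?D. sqfree (fst z)}. (- 1) ^ xdeg (fst z))"
    by (rule sum.inter_filter[symmetric, OF finite_add_decomps])
  also have "\<dots> = (\<Sum>T\<in>Pow ?K. (- 1) ^ card T)"
  proof (rule sum.reindex_bij_witness[where i = "\<lambda>T. (mon T, a - mon T)" and j = "\<lambda>z. Poly_Mapping.keys (fst z)"])
    fix z assume "z \<in> {z \<in> ?D. sqfree (fst z)}"
    then obtain b c where z: "z = (b, c)" and a: "b + c = a" and b: "sqfree b" by auto
    have "mon (Poly_Mapping.keys b) = b"
      by (rule poly_mapping_eqI) (use b in \<open>auto simp: lookup_mon sqfree_def in_keys_iff\<close>)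
    then show "(mon (Poly_Mapping.keys (fst z)), a - mon (Poly_Mapping.keys (fst z))) = z"
      using a by (auto simp: z)
    show "Poly_Mapping.keys (fst z) \<in> Pow ?K"
      by (auto simp: z in_keys_iff lookup_add simp flip: a)
    show "(- 1) ^ card (Poly_Mapping.keys (fst z)) = (- 1 :: rat) ^ xdeg (fst z)"
      by (simp add: z xdeg_sqfree[OF b])
  next
    fix T assume T: "T \<in> Pow ?K"
    have "mon T + (a - mon T) = a"
      by (rule poly_mapping_eqI)
         (use T in \<open>auto simp: lookup_add lookup_minus lookup_mon[OF fin[OF T]] in_keys_iff\<close>)
    moreover have "sqfree (mon T)"
      using fin[OF T] by (simp add: sqfree_def keys_mon lookup_mon)
    ultimately show "(mon T, a - mon T) \<in> {z \<in> ?D. sqfree (fst z)}" by simp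
    show "Poly_Mapping.keys (fst (mon T, a - mon T)) = T"
      using fin[OF T] by (simp add: keys_mon)
  qed
  also have "\<dots> = (if a = 0 then 1 else 0)"
    by (simp add: sum_sign_subsets)
  finally show ?thesis .
qed

lemma e_times_h: "(\<Sum>m=0..N. (- 1) ^ m * e_sym m * h_sym (N - m)) = (if N = 0 then 1 else 0)"
proof (rule sSym_eqI)
  fix S :: "nat set" and a :: "nat \<Rightarrow>\<^sub>0 nat" assume S: "finite S"
  let ?D = "{(b, c). b + c = a}"
  have "scoeff (\<Sum>m=0..N. (- 1) ^ m * e_sym m * h_sym (N - m)) (S, a)
      = (\<Sum>m=0..N. (- 1) ^ m * (\<Sum>(b, c)\<in>?D. scoeff (e_sym m) ({}, b) * scoeff (h_sym (N - m)) (S, c)))"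
    unfolding scoeff_sum mult.assoc scoeff_sign_times
    by (intro sum.cong refl arg_cong2[of _ _ _ _ "(*)"] scoeff_times_theta_free S) (simp add: scoeff_e)
  also have "\<dots> = (\<Sum>z\<in>?D. \<Sum>m=0..N. (- 1) ^ m * (scoeff (e_sym m) ({}, fst z) * scoeff (h_sym (N - m)) (S, snd z)))"
    unfolding case_prod_unfold sum_distrib_left by (rule sum.swap)
  also have "\<dots> = (\<Sum>z\<in>?D. if S = {} \<and> xdeg a = N then if sqfree (fst z) then (- 1) ^ xdeg (fst z) else 0 else 0)"
  proof (rule sum.cong[OF refl])
    fix z assume "z \<in> ?D"
    then obtain b c where z: "z = (b, c)" and a: "b + c = a" by auto
    have "(\<Sum>m=0..N. (- 1) ^ m * (scoeff (e_sym m) ({}, b) * scoeff (h_sym (N - m)) (S, c)))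
        = (\<Sum>m=0..N. if xdeg b = m \<and> xdeg c = N - m then if S = {} \<and> sqfree b then (- 1) ^ m else 0 else 0)"
      unfolding scoeff_h scoeff_e by (intro sum.cong refl) auto
    also have "\<dots> = (if S = {} \<and> xdeg a = N then if sqfree b then (- 1) ^ xdeg b else 0 else 0)"
      unfolding sum_delta_diff by (auto simp: xdeg_add simp flip: a)
    finally show "(\<Sum>m=0..N. (- 1) ^ m * (scoeff (e_sym m) ({}, fst z) * scoeff (h_sym (N - m)) (S, snd z)))
      = (if S = {} \<and> xdeg a = N then if sqfree (fst z) then (- 1) ^ xdeg (fst z) else 0 else 0)" by (simp add: z)
  qed
  also have "\<dots> = (if S = {} \<and> xdeg a = N then if a = 0 then 1 else 0 else 0)"
    by (cases "S = {} \<and> xdeg a = N")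
       (simp_all only: if_True if_False simp_thms sum.neutral_const sum_sign_sqfree_divisors)
  also have "\<dots> = scoeff (if N = 0 then 1 else 0) (S, a)"
    by (auto simp: scoeff_one scoeff_zero xdeg_def)
  finally show "scoeff (\<Sum>m=0..N. (- 1) ^ m * e_sym m * h_sym (N - m)) (S, a)
      = scoeff (if N = 0 then 1 else 0) (S, a)" .
qed

section \<open>Comparison of generating functions\<close>

text \<open>
  The boundary term \<open>r_comp (hook N)\<close> of the telescoping sum is the summand with \<open>m = 0\<close>, because
  \<open>h\<^sub>0 = 1\<close>.
\<close>

lemma h_times_signed_r_hook:
  "(\<Sum>m=0..N. h_sym m * ((- 1) ^ (N - m) * r_comp (hook (N - m)))) = ht_sym N"
proof -
  have "h_sym 0 = 1"
    using e_times_h[of 0] by (simp add: e_sym_def)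
  then show ?thesis
    using r_hook_recursion[of N] by (cases "N = 0") (simp_all add: r_Dot sum.atLeast_Suc_atMost)
qed

theorem proposition7p7:
  fixes n :: nat
  shows "pt_sym n = (- 1) ^ n * r_comp (replicate n (Plain 1) @ [Dot 0])
    \<and> r_comp (replicate n (Plain 1) @ [Dot 0]) = (\<Sum>k=0..n. (- 1) ^ k * e_sym (n - k) * ht_sym k)
    \<and> pt_sym n = (\<Sum>k=0..n. (- 1) ^ (n - k) * e_sym (n - k) * ht_sym k)"
proof -
  define E where "E = Abs_fps (\<lambda>n. (- 1) ^ n * e_sym n)"
  define H where "H = Abs_fps h_sym"
  define T where "T = Abs_fps ht_sym"
  define P where "P = Abs_fps pt_sym"
  define R where "R = Abs_fps (\<lambda>n. (- 1) ^ n * r_comp (hook n))"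
  have EH: "E * H = 1"
    by (rule fps_ext) (simp add: E_def H_def fps_mult_nth e_times_h)
  have HP: "H * P = T" and HR: "H * R = T"
    by (rule fps_ext; simp add: H_def P_def R_def T_def fps_mult_nth h_times_pt h_times_signed_r_hook)+
  have PT: "P = E * T"
    unfolding HP[symmetric] mult.assoc[symmetric] EH by simp
  have "R = E * T"
    unfolding HR[symmetric] mult.assoc[symmetric] EH by simp
  with PT have PR: "P = R" by simp
  have 1: "pt_sym n = (- 1) ^ n * r_comp (hook n)"
    using arg_cong[OF PR, of "\<lambda>f. fps_nth f n"] by (simp add: P_def R_def)
  have "pt_sym n = (\<Sum>k=0..n. (- 1) ^ k * e_sym k * ht_sym (n - k))"
    using arg_cong[OF PT, of "\<lambda>f. fps_nth f n"] by (simp add: P_def E_def T_def fps_mult_nth)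
  also have "\<dots> = (\<Sum>k=0..n. (- 1) ^ (n - k) * e_sym (n - k) * ht_sym k)"
    by (subst sum.atLeastAtMost_rev) (auto intro!: sum.cong)
  finally have 3: "pt_sym n = (\<Sum>k=0..n. (- 1) ^ (n - k) * e_sym (n - k) * ht_sym k)" .
  have "r_comp (hook n) = (- 1) ^ n * pt_sym n"
    unfolding 1 mult.assoc[symmetric] power_add[symmetric] by simp
  also have "\<dots> = (\<Sum>k=0..n. (- 1) ^ k * e_sym (n - k) * ht_sym k)"
    unfolding 3 sum_distrib_left
  proof (intro sum.cong refl)
    fix k assume "k \<in> {0..n}"
    then have "n + (n - k) = 2 * (n - k) + k" by simp
    then have "(- 1 :: sSym) ^ n * (- 1) ^ (n - k) = (- 1) ^ (2 * (n - k) + k)"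
      by (metis power_add)
    then have "(- 1 :: sSym) ^ n * (- 1) ^ (n - k) = (- 1) ^ k"
      by (simp add: power_add power_mult)
    then show "(- 1) ^ n * ((- 1) ^ (n - k) * e_sym (n - k) * ht_sym k) = (- 1) ^ k * e_sym (n - k) * ht_sym k"
      by (simp add: mult.assoc[symmetric])
  qed
  finally show ?thesis using 1 3 by simp
qed

end
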